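(* There exist constants $0.1<\delta\le\lambda<0.9$ such that, for any integer $k\ge 2$, almost surely $$\lim_{n\to\infty}\frac{X_n^{\ge k}}{n^{\delta}}=\infty\quad\text{and}\quad \lim_{n\to\infty}\frac{X_n^{\ge k}}{n^{\lambda}}=0 .$$
   Context: The random friend tree process $(T_n)_{n\ge 2}$ is defined as follows. $T_2$ is a single edge joining vertices labelled $1$ and $2$. For $n\ge 2$, given $T_n$ (and the past of the process), $V_n$ is chosen uniformly at random in $\{1,\dots,n\}$, and then $W_n$ is a uniformly random neighbour of $V_n$ in $T_n$; $T_{n+1}$ is obtained from $T_n$ by adding a new vertex labelled $n+1$ joined by an edge to $W_n$. Thus $T_n$ is a tree with vertex set $[n]=\{1,\dots,n\}$. $X_n^{\ge k}$ denotes the number of vertices of $T_n$ whose degree in $T_n$ is at least $k$. *)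

theory Defs
  imports "HOL-Probability.Probability"
begin

text \<open>A finite graph on the vertex set \<open>{1..n}\<close> is represented by its set of edges, an edge
  being an unordered pair of vertices.\<close>

definition neighbours :: "nat set set \<Rightarrow> nat \<Rightarrow> nat set" where
  "neighbours G v = {w. {v, w} \<in> G}"

definition vertex_degree :: "nat set set \<Rightarrow> nat \<Rightarrow> nat" where
  "vertex_degree G v = card (neighbours G v)"

text \<open>A sample point \<open>\<omega>\<close> lists the choices made by the process: \<open>\<omega> n = (V\<^sub>n, W\<^sub>n)\<close> for \<open>n \<ge> 2\<close>
  (the entries at 0 and 1 are unused).  The tree at time \<open>n\<close>
  is a function of the choices at times \<open>2, \<dots>, n - 1\<close>; for \<open>n < 2\<close> its value is a
  dummy.\<close>

primrec friend_tree :: "(nat \<Rightarrow> nat \<times> nat) \<Rightarrow> nat \<Rightarrow> nat set set" where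
  "friend_tree \<omega> 0 = {{1, 2}}"
| "friend_tree \<omega> (Suc n) =
     (if n < 2 then {{1, 2}} else insert {Suc n, snd (\<omega> n)} (friend_tree \<omega> n))"

text \<open>The conditional law of \<open>(V\<^sub>n, W\<^sub>n)\<close> given the choices at times smaller than \<open>n\<close>.  The set of
  neighbours is empty only for histories of probability zero.\<close>

definition friend_step :: "nat \<Rightarrow> (nat \<Rightarrow> nat \<times> nat) \<Rightarrow> (nat \<times> nat) pmf" where
  "friend_step n \<omega> =
     (if n < 2 then return_pmf (0, 0)
      else bind_pmf (pmf_of_set {1..n}) (\<lambda>v.
           bind_pmf (pmf_of_set (neighbours (friend_tree \<omega> n) v)) (\<lambda>w.
           return_pmf (v, w))))"

lemma friend_tree_cong:
  "(\<And>i. i < n \<Longrightarrow> \<omega> i = \<omega>' i) \<Longrightarrow> friend_tree \<omega> n = friend_tree \<omega>' n"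
  by (induction n) auto

lemma friend_step_cong:
  "(\<And>i. i < n \<Longrightarrow> \<omega> i = \<omega>' i) \<Longrightarrow> friend_step n \<omega> = friend_step n \<omega>'"
  unfolding friend_step_def using friend_tree_cong[of n \<omega> \<omega>'] by simp

lemma measurable_friend_tree:
  assumes "\<And>i. i < n \<Longrightarrow> (\<lambda>\<omega>. \<omega> i) \<in> measurable M (count_space UNIV)"
  shows "(\<lambda>\<omega>. friend_tree \<omega> n) \<in> measurable M (count_space UNIV)"
  using assms
proof (induction n)
  case (Suc n)
  have T: "(\<lambda>\<omega>. friend_tree \<omega> n) \<in> measurable M (count_space UNIV)"
    using Suc by simp
  have "(\<lambda>\<omega>. insert {Suc n, snd (\<omega> n)} (friend_tree \<omega> n)) \<in> measurable M (count_space UNIV)"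
    by (rule measurable_compose_countable
          [where f = "\<lambda>p \<omega>. insert {Suc n, snd p} (friend_tree \<omega> n)" and g = "\<lambda>\<omega>. \<omega> n"])
      (use Suc.prems in \<open>auto intro: measurable_compose[OF T]\<close>)
  then show ?case by simp
qed simp

lemma measurable_friend_step:
  "(\<lambda>\<omega>. measure_pmf (friend_step n \<omega>))
     \<in> measurable (PiM {0..<n} (\<lambda>_. count_space UNIV)) (subprob_algebra (count_space UNIV))"
proof -
  have T: "(\<lambda>\<omega>. friend_tree \<omega> n)
      \<in> measurable (PiM {0..<n} (\<lambda>_. count_space UNIV)) (count_space UNIV)"
    by (rule measurable_friend_tree) simp
  show ?thesis
    unfolding friend_step_def
    by (rule measurable_compose[OF T]) (auto simp: measure_pmf_in_subprob_algebra)
qed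

interpretation friend: Ionescu_Tulcea
  "\<lambda>n \<omega>. measure_pmf (friend_step n \<omega>)" "\<lambda>_. count_space UNIV"
  by standard (auto simp: measurable_friend_step measure_pmf.prob_space_axioms)

text \<open>The law of the sequence of choices \<open>(V\<^sub>n, W\<^sub>n)\<close>, on the product \<open>\<sigma>\<close>-algebra.\<close>

definition friend_process :: "(nat \<Rightarrow> nat \<times> nat) measure" where
  "friend_process = friend.PF.lim"

text \<open>\<open>X\<^sub>n\<^sup>\<ge>\<^sup>k\<close> is \<open>num_degree_ge k n\<close>.\<close>

definition num_degree_ge :: "nat \<Rightarrow> nat \<Rightarrow> (nat \<Rightarrow> nat \<times> nat) \<Rightarrow> nat" where
  "num_degree_ge k n \<omega> = card {v \<in> {1..n}. k \<le> vertex_degree (friend_tree \<omega> n) v}"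

lemma sets_friend_process:
  "sets friend_process = sets (PiM UNIV (\<lambda>_. count_space UNIV))"
  by (simp add: friend_process_def)

lemma space_friend_process: "space friend_process = UNIV"
  by (simp add: friend_process_def space_PiM)

lemma prob_space_friend_process: "prob_space friend_process"
proof
  have "emeasure friend_process (friend.PF.emb UNIV {} {\<lambda>_. undefined}) = 
      emeasure (friend.CI {}) {\<lambda>_. undefined}"
    unfolding friend_process_def by (rule friend.lim) (auto simp: PiM_empty)
  also have "\<dots> = 1"
    using friend.PF.prob_space_P[of "{}", THEN prob_space.emeasure_space_1]
    by (simp add: friend.CI_def PiM_empty)
  finally show "emeasure friend_process (space friend_process) = 1"
    by (simp add: space_friend_process prod_emb_def restrict_def)
qed

lemma emeasure_friend_process_cylinder:
  "emeasure friend_process {\<omega>. \<forall>i<n. \<omega> i = x i} = (\<Prod>i<n. ennreal (pmf (friend_step i x) (x i)))"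
proof -
  let ?M = "\<lambda>_::nat. count_space (UNIV :: (nat \<times> nat) set)"
  let ?r = "\<lambda>n. restrict x {0..<n}"
  have S: "{?r n} \<in> sets (PiM {0..<n} ?M)" for n
  proof -
    have "{?r n} = PiE {0..<n} (\<lambda>i. {x i})"
      by (auto simp: PiE_iff extensional_def fun_eq_iff restrict_def)
    then show ?thesis by (auto intro!: sets_PiM_I_finite)
  qed
  have C: "emeasure (friend.C 0 n (\<lambda>_. undefined)) {?r n} =
      (\<Prod>i<n. ennreal (pmf (friend_step i x) (x i)))" for n
  proof (induction n)
    case 0
    then show ?case by (simp add: PiM_empty restrict_def)
  next
    case (Suc n)
    have mem: "(\<lambda>_. undefined) \<in> space (PiM {0..<0} ?M)" by (simp add: space_PiM)
    have E: "emeasure (friend.eP n \<omega>) {?r (Suc n)} =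
        ennreal (pmf (friend_step n x) (x n)) * indicator {?r n} \<omega>"
      if w: "\<omega> \<in> space (PiM {0..<n} ?M)" for \<omega>
    proof -
      have 1: "fun_upd \<omega> n p = ?r (Suc n) \<longleftrightarrow> \<omega> = ?r n \<and> p = x n" for p
      proof
        assume a: "fun_upd \<omega> n p = ?r (Suc n)"
        have "\<omega> i = ?r n i" for i
          using fun_cong[OF a, of i] w
          by (cases "i < n") (auto simp: space_PiM PiE_iff extensional_def)
        then show "\<omega> = ?r n \<and> p = x n"
          using fun_cong[OF a, of n] by auto
      qed (auto simp: fun_eq_iff)
      have 2: "fun_upd \<omega> n -` {?r (Suc n)} = (if \<omega> = ?r n then {x n} else {})"
        using 1 by auto
      have 3: "friend_step n (?r n) = friend_step n x"
        by (rule friend_step_cong) simp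
      show ?thesis
        using S[of "Suc n"] w 2 3 by (simp add: friend.emeasure_eP emeasure_pmf_single)
    qed
    have "emeasure (friend.C 0 (Suc n) (\<lambda>_. undefined)) {?r (Suc n)} =
        (\<integral>\<^sup>+\<omega>. emeasure (friend.eP n \<omega>) {?r (Suc n)} \<partial>friend.C 0 n (\<lambda>_. undefined))"
      using S[of "Suc n"] friend.measurable_eP[of n] 
      by (simp add: emeasure_bind[where N = "PiM {0..<Suc n} ?M"] friend.space_C[OF mem]
          measurable_cong_sets[OF friend.sets_C[OF mem] refl])
    also have "\<dots> = (\<integral>\<^sup>+\<omega>. ennreal (pmf (friend_step n x) (x n)) * indicator {?r n} \<omega>
        \<partial>friend.C 0 n (\<lambda>_. undefined))"
      by (rule nn_integral_cong) (use E friend.space_C[OF mem] in simp)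
    also have "\<dots> = ennreal (pmf (friend_step n x) (x n)) *
        emeasure (friend.C 0 n (\<lambda>_. undefined)) {?r n}"
      using S[of n] by (subst nn_integral_cmult_indicator) (simp_all add: friend.sets_C[OF mem])
    finally show ?case
      by (simp only: Suc.IH prod.lessThan_Suc mult.commute)
  qed
  have "{\<omega>. \<forall>i<n. \<omega> i = x i} = friend.PF.emb UNIV {0..<n} {?r n}"
    by (auto simp: prod_emb_def fun_eq_iff restrict_def split: if_splits)
  then have "emeasure friend_process {\<omega>. \<forall>i<n. \<omega> i = x i} = emeasure (friend.CI {0..<n}) {?r n}"
    unfolding friend_process_def using friend.lim[OF _ S] by simp
  also have "\<dots> = emeasure (friend.C 0 n (\<lambda>_. undefined)) {?r n}"
    using friend.emeasure_CI[of "{0..<n}" n, OF _ S] S[of n]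
    by (simp add: prod_emb_id sets.sets_into_space[OF S] PiE_UNIV_domain)
  finally show ?thesis by (simp add: C)
qed

end

theory Submission
  imports Defs "HOL-Real_Asymp.Real_Asymp"
begin

text \<open>
  Call a vertex of degree at least 2 a hub, write $l(v)$ for the number of leaves adjacent to $v$ and
  $d(v)$ for its degree.  Once there are three vertices, every leaf hangs on a hub, and so one step
  of the process is one of two moves: the new vertex is attached to a hub $v$, and $l(v)$ grows by
  one; or it is attached to a leaf hanging on a hub $p$, which turns this leaf into a hub with one
  leaf and lowers $l(p)$ by one.  Multiplied by $n$, the probability of the first move at $v$ is
  the sum of $1/d(u)$ over the neighbours $u$ of $v$, hence at least $l(v)$, and the probability of
  the second move at $p$ is $l(p)/d(p) \<le> 1$.  All estimates concern sums over the hubs $v$ of a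
  function $g(l(v))$, whose conditional drift is therefore a sum of local terms
  (\<open>step_mean_hub_sum\<close>).

  Upper bound.  A hub adjacent mostly to leaves produces new hubs at rate close to $1/n$, but each new hub
  starts with a single leaf and hence with rate at most $1/(2n)$.  Giving weight 5 to hubs with at most one
  leaf and weight 6 to the others uses this: the expected total weight grows by a factor of at most
  $1 + (5/6)/n$ per step (\<open>step_mean_ceiling\<close>) and so is of order at most $n^{5/6}$.  Since the number
  of hubs never decreases, Markov's inequality at the powers of two shows that almost surely there
  are at most about $n^{6/7}$ hubs, which bounds the number of vertices of degree at least $k$ for
  every $k \<ge> 2$.

  Lower bound.  Give weight 3 to hubs with one leaf, weight 4 to hubs with more leaves and weight 0
  to those without leaves.  The total weight $S$ never decreases, and its drift is at least $S/(4n)$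
  (\<open>growth_weight_drift\<close>).  It is here that it matters that the graph is a tree: the hubs span a
  subtree, so that a hub has on average at most two adjacent hubs, and leaves cannot be rare among
  the neighbours of those hubs that have any.  As $S$ has bounded jumps, the mean of $1/S$ decays like $n^{-1/7}$, and
  as $S$ is monotone it exceeds a multiple of $n^{1/8}$ almost surely for all large $n$.  Up to a
  factor, the number of hubs with at least one leaf does so as well.

  Large degrees.  Let $Z_j$ count the hubs with at least $j$ leaves.  Hubs with exactly $j$ leaves enter
  $Z_{j+1}$ at rate at least $1/n$ each, and every hub leaves it at rate at most $1/n$.  Hence, while $Z_j \<ge> b$, the
  count $Z_{j+1}$ is pushed upwards until it reaches a fixed fraction of $b$, and $2^{-Z_{j+1}}$ has
  a mean that is exponentially small in a multiple of $n^{1/8}$ if $b$ is a multiple of $n^{1/8}$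
  (\<open>step_mean_rich_le\<close>).  By induction on $j$, every $Z_j$ is almost surely at least of order $n^{1/8}$
  (\<open>AE_rich_hubs\<close>), and a hub with $k$ leaves has degree at least $k$.  This gives the
  exponents $1/9$ and $7/8$.
\<close>

section \<open>Attaching a vertex to a tree\<close>

definition leaf_nbrs :: "nat set set \<Rightarrow> nat \<Rightarrow> nat set" where
  "leaf_nbrs G v = {u \<in> neighbours G v. vertex_degree G u = 1}"

definition leaf_count :: "nat set set \<Rightarrow> nat \<Rightarrow> nat" where
  "leaf_count G v = card (leaf_nbrs G v)"

definition hubs :: "nat set set \<Rightarrow> nat set" where
  "hubs G = {v. 2 \<le> vertex_degree G v}"

definition hub_sum :: "(nat \<Rightarrow> real) \<Rightarrow> nat set set \<Rightarrow> real" where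
  "hub_sum g G = (\<Sum>v\<in>hubs G. g (leaf_count G v))"

text \<open>The probability that the next vertex is attached to \<open>w\<close>, multiplied by the number of vertices.\<close>

definition attach_weight :: "nat set set \<Rightarrow> nat \<Rightarrow> real" where
  "attach_weight G w = (\<Sum>v\<in>neighbours G w. 1 / real (vertex_degree G v))"

lemma neighbours_sym: "u \<in> neighbours G v \<longleftrightarrow> v \<in> neighbours G u"
  by (simp add: neighbours_def insert_commute)

lemma neighbours_insert:
  assumes "neighbours G x = {}" "w \<noteq> x"
  shows "neighbours (insert {x, w} G) v =
    (if v = x then {w} else if v = w then insert x (neighbours G w) else neighbours G v)"
  using assms by (auto simp: neighbours_def doubleton_eq_iff)

text \<open>The properties of a tree on \<open>{1..n}\<close> that the drift estimates need.  The last one replaces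
  acyclicity: the left side counts every edge between two hubs twice, and a forest on the
  hubs has fewer edges than vertices.  Stated in this form, all of them are inherited when a vertex
  is attached.\<close>

locale friend_graph =
  fixes n :: nat and G :: "nat set set"
  assumes size: "3 \<le> n"
    and nbrs: "neighbours G v \<subseteq> {1..n} - {v}"
    and nbrs_nonempty: "v \<in> {1..n} \<Longrightarrow> neighbours G v \<noteq> {}"
    and leaf_nbr_hub: "vertex_degree G v = 1 \<Longrightarrow> u \<in> neighbours G v \<Longrightarrow> u \<in> hubs G"
    and hub_edges: "(\<Sum>v\<in>hubs G. real (vertex_degree G v) - real (leaf_count G v)) \<le> 2 * real (card (hubs G))"
begin

lemma finite_nbrs: "finite (neighbours G v)"
  using nbrs finite_subset by blast

lemma nbrs_outside: "v \<notin> {1..n} \<Longrightarrow> neighbours G v = {}"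
  using nbrs neighbours_sym by blast

lemma vertex_degree_pos: "v \<in> {1..n} \<Longrightarrow> 1 \<le> vertex_degree G v"
  using nbrs_nonempty finite_nbrs by (simp add: vertex_degree_def Suc_le_eq card_gt_0_iff)

lemma hubs_subset: "hubs G \<subseteq> {1..n}"
  using nbrs_outside by (force simp: hubs_def vertex_degree_def)

lemma finite_hubs: "finite (hubs G)"
  using hubs_subset finite_subset by blast

lemma finite_leaf_nbrs: "finite (leaf_nbrs G v)"
  using finite_nbrs by (simp add: leaf_nbrs_def)

lemma leaf_count_le: "leaf_count G v \<le> vertex_degree G v"
  unfolding leaf_count_def vertex_degree_def
  by (rule card_mono) (auto simp: finite_nbrs leaf_nbrs_def)

lemma leaf_nbrs_of_leaf: "v \<notin> hubs G \<Longrightarrow> leaf_nbrs G v = {}"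
  using leaf_nbr_hub by (auto simp: leaf_nbrs_def neighbours_sym)

lemma leaf_nbrsD:
  assumes "w \<in> leaf_nbrs G p"
  shows "p \<in> hubs G" "w \<notin> hubs G" "w \<in> {1..n}" "neighbours G w = {p}" "w \<noteq> p" 
    "leaf_nbrs G w = {}" "1 \<le> leaf_count G p" "vertex_degree G w = 1"
proof -
  show deg: "vertex_degree G w = 1" and w: "w \<notin> hubs G"
    using assms by (auto simp: leaf_nbrs_def hubs_def)
  have p: "p \<in> neighbours G w"
    using assms by (auto simp: leaf_nbrs_def neighbours_sym)
  with deg show "neighbours G w = {p}"
    unfolding vertex_degree_def by (auto simp: card_1_singleton_iff)
  show ph: "p \<in> hubs G" using deg p by (rule leaf_nbr_hub)
  show "w \<in> {1..n}"
    using assms subsetD[OF nbrs[of p], of w] unfolding leaf_nbrs_def by blast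
  show "w \<noteq> p" using w ph by auto
  show "leaf_nbrs G w = {}" using w by (rule leaf_nbrs_of_leaf)
  show "1 \<le> leaf_count G p"
    using assms finite_leaf_nbrs by (auto simp: leaf_count_def Suc_le_eq card_gt_0_iff)
qed

lemma vertices_decompose: "{1..n} = hubs G \<union> (\<Union>p\<in>hubs G. leaf_nbrs G p)" (is "_ = ?R")
proof
  show "?R \<subseteq> {1..n}" using hubs_subset leaf_nbrsD(3) by blast
  show "{1..n} \<subseteq> ?R"
  proof
    fix v assume v: "v \<in> {1..n}"
    show "v \<in> ?R"
    proof (cases "v \<in> hubs G")
      case False
      then have deg: "vertex_degree G v = 1" using vertex_degree_pos[OF v] by (auto simp: hubs_def)
      obtain p where "p \<in> neighbours G v" using nbrs_nonempty[OF v] by auto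
      then show ?thesis using leaf_nbr_hub[OF deg] deg by (auto simp: leaf_nbrs_def neighbours_sym)
    qed auto
  qed
qed

lemma sum_vertices:
  fixes f :: "nat \<Rightarrow> real"
  shows "(\<Sum>w\<in>{1..n}. f w) = (\<Sum>v\<in>hubs G. f v + (\<Sum>w\<in>leaf_nbrs G v. f w))"
proof -
  have "(\<Sum>w\<in>{1..n}. f w) = sum f (hubs G) + sum f (\<Union>p\<in>hubs G. leaf_nbrs G p)"
    unfolding vertices_decompose
  proof (rule sum.union_disjoint)
    show "hubs G \<inter> (\<Union>p\<in>hubs G. leaf_nbrs G p) = {}"
      using leaf_nbrsD(2) by blast
  qed (simp_all add: finite_hubs finite_leaf_nbrs)
  also have "sum f (\<Union>p\<in>hubs G. leaf_nbrs G p) = (\<Sum>v\<in>hubs G. \<Sum>w\<in>leaf_nbrs G v. f w)"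
  proof (rule sum.UNION_disjoint)
    show "\<forall>i\<in>hubs G. \<forall>j\<in>hubs G. i \<noteq> j \<longrightarrow> leaf_nbrs G i \<inter> leaf_nbrs G j = {}"
    proof (intro ballI impI, rule ccontr)
      fix i j assume "i \<noteq> j" "leaf_nbrs G i \<inter> leaf_nbrs G j \<noteq> {}"
      then obtain w where "w \<in> leaf_nbrs G i" "w \<in> leaf_nbrs G j" by blast
      from this[THEN leaf_nbrsD(4)] \<open>i \<noteq> j\<close> show False by simp
    qed
  qed (simp_all add: finite_hubs finite_leaf_nbrs)
  finally show ?thesis by (simp add: sum.distrib)
qed

lemma attach_weight_leaf: "w \<in> leaf_nbrs G p \<Longrightarrow> attach_weight G w = 1 / real (vertex_degree G p)"
  by (simp add: attach_weight_def leaf_nbrsD(4))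

lemma attach_weight_ge: "real (leaf_count G w) \<le> attach_weight G w"
proof -
  have "real (leaf_count G w) = (\<Sum>v\<in>leaf_nbrs G w. 1 / real (vertex_degree G v))"
    by (simp add: leaf_count_def leaf_nbrs_def)
  also have "\<dots> \<le> attach_weight G w"
    unfolding attach_weight_def by (rule sum_mono2) (auto simp: finite_nbrs leaf_nbrs_def)
  finally show ?thesis .
qed

text \<open>Double counting of the pairs \<open>(V\<^sub>n, W\<^sub>n)\<close>: the left side sums over the first choice, the
  right side over the second.\<close>

lemma sum_attach_weight_vertices: "(\<Sum>v\<in>{1..n}. (\<Sum>w\<in>neighbours G v. h w) / real (vertex_degree G v)) =
    (\<Sum>w\<in>{1..n}. attach_weight G w * h w)"
proof -
  have eq: "(\<Sum>w\<in>neighbours G v. f v w) = (\<Sum>w\<in>{1..n}. if w \<in> neighbours G v then f v w else 0)" 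
    for f :: "nat \<Rightarrow> nat \<Rightarrow> real" and v
  proof -
    have "{1..n} \<inter> neighbours G v = neighbours G v" using nbrs[of v] by blast
    then show ?thesis using sum.inter_restrict[of "{1..n}" "f v" "neighbours G v"] by simp
  qed
  have "(\<Sum>v\<in>{1..n}. (\<Sum>w\<in>neighbours G v. h w) / real (vertex_degree G v)) =
      (\<Sum>v\<in>{1..n}. \<Sum>w\<in>neighbours G v. h w / real (vertex_degree G v))"
    by (simp add: sum_divide_distrib)
  also have "\<dots> = (\<Sum>v\<in>{1..n}. \<Sum>w\<in>{1..n}. if w \<in> neighbours G v then h w / real (vertex_degree G v) else 0)"
    by (rule sum.cong[OF refl], rule eq)
  also have "\<dots> = (\<Sum>w\<in>{1..n}. \<Sum>v\<in>{1..n}. if w \<in> neighbours G v then h w / real (vertex_degree G v) else 0)"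
    by (rule sum.swap)
  also have "\<dots> = (\<Sum>w\<in>{1..n}. \<Sum>v\<in>neighbours G w. h w / real (vertex_degree G v))"
  proof (rule sum.cong[OF refl])
    fix w
    show "(\<Sum>v\<in>{1..n}. if w \<in> neighbours G v then h w / real (vertex_degree G v) else 0) =
        (\<Sum>v\<in>neighbours G w. h w / real (vertex_degree G v))"
      unfolding neighbours_sym[of w] by (rule eq[of "\<lambda>w v. h w / real (vertex_degree G v)", symmetric])
  qed
  also have "\<dots> = (\<Sum>w\<in>{1..n}. attach_weight G w * h w)"
    by (simp add: attach_weight_def sum_distrib_right)
  finally show ?thesis .
qed

text \<open>The targets are grouped by hubs: a hub itself and the leaves hanging on it, each of
  which is chosen only through the hub.\<close>

lemma sum_attach_weight:
  "(\<Sum>w\<in>{1..n}. attach_weight G w * h w) =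
    (\<Sum>v\<in>hubs G. attach_weight G v * h v + (\<Sum>w\<in>leaf_nbrs G v. h w) / real (vertex_degree G v))"
proof -
  have "(\<Sum>w\<in>leaf_nbrs G v. attach_weight G w * h w) =
      (\<Sum>w\<in>leaf_nbrs G v. h w) / real (vertex_degree G v)" for v
  proof -
    have "(\<Sum>w\<in>leaf_nbrs G v. attach_weight G w * h w) =
        (\<Sum>w\<in>leaf_nbrs G v. h w / real (vertex_degree G v))"
      by (rule sum.cong) (simp_all add: attach_weight_leaf[of _ v])
    then show ?thesis by (simp add: sum_divide_distrib)
  qed
  then show ?thesis
    using sum_vertices[of "\<lambda>w. attach_weight G w * h w"] by simp
qed

text \<open>Total probability.  Compared with \<open>sum_leaf_count\<close>, this bounds how often hubs are reached
  through other hubs.\<close>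

lemma sum_attach_weight_total:
  "(\<Sum>v\<in>hubs G. attach_weight G v + real (leaf_count G v) / real (vertex_degree G v)) = real n"
proof -
  have *: "1 = (\<Sum>w\<in>neighbours G v. 1) / real (vertex_degree G v)" if "v \<in> {1..n}" for v
    using vertex_degree_pos[OF that] by (simp add: vertex_degree_def)
  have "real n = (\<Sum>v\<in>{1..n}. 1)" by simp
  also have "\<dots> = (\<Sum>v\<in>{1..n}. (\<Sum>w\<in>neighbours G v. 1) / real (vertex_degree G v))"
    by (rule sum.cong[OF refl], rule *)
  also have "\<dots> = (\<Sum>w\<in>{1..n}. attach_weight G w * 1)"
    by (rule sum_attach_weight_vertices)
  also have "\<dots> = (\<Sum>v\<in>hubs G. attach_weight G v * 1 + (\<Sum>w\<in>leaf_nbrs G v. 1) / real (vertex_degree G v))"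
    by (rule sum_attach_weight)
  finally show ?thesis by (simp add: leaf_count_def)
qed

lemma sum_leaf_count: "(\<Sum>v\<in>hubs G. 1 + real (leaf_count G v)) = real n"
  using sum_vertices[of "\<lambda>_. 1"] by (simp add: leaf_count_def)

context
  fixes w assumes w: "w \<in> {1..n}"
begin

abbreviation "G' \<equiv> insert {Suc n, w} G"

lemma neighbours_attach: "neighbours G' v =
    (if v = Suc n then {w} else if v = w then insert (Suc n) (neighbours G w) else neighbours G v)"
  using w by (intro neighbours_insert nbrs_outside) auto

lemma new_vertex_notin: "Suc n \<notin> neighbours G v"
  using nbrs[of v] by auto

lemma degree_attach: "vertex_degree G' v =
    (if v = Suc n then 1 else if v = w then Suc (vertex_degree G w) else vertex_degree G v)"
  using finite_nbrs[of w] new_vertex_notin[of w] by (auto simp: vertex_degree_def neighbours_attach)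

lemma leaf_nbrs_attach_hub:
  assumes "w \<in> hubs G"
  shows "leaf_nbrs G' v = (if v = w then insert (Suc n) (leaf_nbrs G w) else leaf_nbrs G v)"
  using assms w new_vertex_notin nbrs_outside[of "Suc n"]
  by (auto simp: leaf_nbrs_def neighbours_attach degree_attach hubs_def split: if_splits)

lemma leaf_nbrs_attach_leaf:
  assumes p: "w \<in> leaf_nbrs G p"
  shows "leaf_nbrs G' v = (if v = w then {Suc n} else if v = p then leaf_nbrs G p - {w} else leaf_nbrs G v)"
proof -
  note D = leaf_nbrsD[OF p]
  have "w \<in> neighbours G v \<Longrightarrow> v = p" for v
    using D(4) neighbours_sym by blast
  moreover have "vertex_degree G p \<noteq> 1" using D(1) by (auto simp: hubs_def)
  moreover have "p \<noteq> Suc n" using D(1) hubs_subset by auto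
  ultimately show ?thesis
    using D w new_vertex_notin nbrs_outside[of "Suc n"]
    by (auto simp: leaf_nbrs_def neighbours_attach degree_attach hubs_def split: if_splits)
qed

lemma hubs_attach: "hubs G' = insert w (hubs G)"
  using w vertex_degree_pos[OF w] nbrs_outside[of "Suc n"]
  by (auto simp: hubs_def degree_attach vertex_degree_def[of G "Suc n"])

lemma leaf_count_attach_hub:
  assumes "w \<in> hubs G"
  shows "leaf_count G' v = (if v = w then Suc (leaf_count G w) else leaf_count G v)"
  using finite_leaf_nbrs[of w] new_vertex_notin[of w] 
  by (auto simp: leaf_count_def leaf_nbrs_attach_hub[OF assms]) (auto simp: leaf_nbrs_def)

lemma leaf_count_attach_leaf:
  assumes "w \<in> leaf_nbrs G p"
  shows "leaf_count G' v = (if v = w then 1 else if v = p then leaf_count G p - 1 else leaf_count G v)"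
  using finite_leaf_nbrs[of p] assms
  by (auto simp: leaf_count_def leaf_nbrs_attach_leaf[OF assms])

lemma sum_attach_hub:
  fixes f f' :: "nat \<Rightarrow> real"
  assumes "w \<in> hubs G" "\<And>v. v \<in> hubs G \<Longrightarrow> v \<noteq> w \<Longrightarrow> f' v = f v"
  shows "sum f' (hubs G') = sum f (hubs G) + f' w - f w"
proof -
  have "hubs G' = hubs G" using assms(1) hubs_attach by auto
  moreover have "sum f' (hubs G - {w}) = sum f (hubs G - {w})"
    using assms(2) by (intro sum.cong) auto
  ultimately show ?thesis
    using sum.remove[OF finite_hubs assms(1), of f] sum.remove[OF finite_hubs assms(1), of f'] by simp
qed

lemma sum_attach_leaf:
  fixes f f' :: "nat \<Rightarrow> real"
  assumes p: "w \<in> leaf_nbrs G p" and "\<And>v. v \<in> hubs G \<Longrightarrow> v \<noteq> w \<Longrightarrow> v \<noteq> p \<Longrightarrow> f' v = f v"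
  shows "sum f' (hubs G') = sum f (hubs G) + f' w + f' p - f p"
proof -
  note D = leaf_nbrsD[OF p]
  have "sum f' (hubs G') = f' w + sum f' (hubs G)"
    using D(2) finite_hubs by (simp add: hubs_attach)
  moreover have "sum f' (hubs G - {p}) = sum f (hubs G - {p})"
    using assms(2) D(2) by (intro sum.cong) auto
  ultimately show ?thesis
    using sum.remove[OF finite_hubs D(1), of f] sum.remove[OF finite_hubs D(1), of f'] by simp
qed

lemma hub_sum_attach_hub:
  assumes "w \<in> hubs G"
  shows "hub_sum g G' = hub_sum g G + g (Suc (leaf_count G w)) - g (leaf_count G w)"
  unfolding hub_sum_def
  using sum_attach_hub[OF assms, of "\<lambda>v. g (leaf_count G' v)" "\<lambda>v. g (leaf_count G v)"]
  by (simp add: leaf_count_attach_hub[OF assms])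

lemma hub_sum_attach_leaf:
  assumes "w \<in> leaf_nbrs G p"
  shows "hub_sum g G' = hub_sum g G + g 1 + g (leaf_count G p - 1) - g (leaf_count G p)"
  unfolding hub_sum_def
  using sum_attach_leaf[OF assms, of "\<lambda>v. g (leaf_count G' v)" "\<lambda>v. g (leaf_count G v)"] 
    leaf_nbrsD(5)[OF assms]
  by (auto simp: leaf_count_attach_leaf[OF assms])

lemma attach_cases:
  obtains "w \<in> hubs G" | p where "w \<in> leaf_nbrs G p"
  using w vertices_decompose by blast

text \<open>Only attaching to a leaf changes both sides of the bound on the edges between hubs: it creates
  one hub and one such edge, which raises both sides by 2.\<close>

lemma friend_graph_attach: "friend_graph (Suc n) G'"
proof
  show "3 \<le> Suc n" using size by simp
  show "neighbours G' v \<subseteq> {1..Suc n} - {v}" for v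
    using nbrs[of v] w by (auto simp: neighbours_attach)
  show "neighbours G' v \<noteq> {}" if "v \<in> {1..Suc n}" for v
    using nbrs_nonempty[of v] that by (cases "v = Suc n") (auto simp: neighbours_attach)
  show "u \<in> hubs G'" if "vertex_degree G' v = 1" "u \<in> neighbours G' v" for u v
  proof (cases "v = Suc n")
    case True
    with that show ?thesis by (auto simp: neighbours_attach hubs_attach)
  next
    case False
    with that vertex_degree_pos[OF w] have "v \<noteq> w" by (auto simp: degree_attach)
    with False that show ?thesis
      using leaf_nbr_hub[of v u] by (auto simp: neighbours_attach hubs_attach degree_attach)
  qed
  let ?f = "\<lambda>G v. real (vertex_degree G v) - real (leaf_count G v)"
  show "(\<Sum>v\<in>hubs G'. ?f G' v) \<le> 2 * real (card (hubs G'))"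
  proof (cases rule: attach_cases)
    case 1
    have "(\<Sum>v\<in>hubs G'. ?f G' v) = sum (?f G) (hubs G) + ?f G' w - ?f G w"
    proof (rule sum_attach_hub[OF 1])
      fix v assume "v \<in> hubs G" "v \<noteq> w"
      then show "?f G' v = ?f G v"
        using hubs_subset by (auto simp: degree_attach leaf_count_attach_hub[OF 1])
    qed
    also have "?f G' w = ?f G w"
      using w by (simp add: degree_attach leaf_count_attach_hub[OF 1])
    also have "hubs G = hubs G'"
      using 1 by (auto simp: hubs_attach)
    finally show ?thesis
      using hub_edges by (simp add: \<open>hubs G = hubs G'\<close>)
  next
    case (2 p)
    note D = leaf_nbrsD[OF 2]
    have pn: "p \<noteq> Suc n" using D(1) hubs_subset by auto
    have "(\<Sum>v\<in>hubs G'. ?f G' v) = sum (?f G) (hubs G) + ?f G' w + ?f G' p - ?f G p"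
    proof (rule sum_attach_leaf[OF 2])
      fix v assume "v \<in> hubs G" "v \<noteq> w" "v \<noteq> p"
      then show "?f G' v = ?f G v"
        using hubs_subset by (auto simp: degree_attach leaf_count_attach_leaf[OF 2])
    qed
    also have "?f G' w = 1"
      using w D(8) by (simp add: degree_attach leaf_count_attach_leaf[OF 2])
    also have "?f G' p = ?f G p + 1"
      using D(5,7) pn by (simp add: degree_attach leaf_count_attach_leaf[OF 2] of_nat_diff)
    finally show ?thesis
      using hub_edges D(2) finite_hubs by (simp add: hubs_attach)
  qed
qed

end

end

section \<open>Conditional means of sums over hubs\<close>

definition step_mean :: "nat \<Rightarrow> nat set set \<Rightarrow> (nat set set \<Rightarrow> real) \<Rightarrow> real" where
  "step_mean n G f = (\<Sum>w\<in>{1..n}. attach_weight G w * f (insert {Suc n, w} G)) / real n"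

text \<open>The difference of 1 between the positive values is a compromise: it is all that a hub with one leaf
  gains by its second leaf, and it is lost again when a hub with two leaves gives one up.\<close>

definition growth_weight :: "nat \<Rightarrow> real" where
  "growth_weight l = (if l = 0 then 0 else if l = 1 then 3 else 4)"

text \<open>The excess of 1 over 5 balances the two kinds of hubs: it is gained when a hub receives its
  second leaf, and it pays for the higher rate at which the hub then produces new hubs.\<close>

definition ceiling_weight :: "nat \<Rightarrow> real" where
  "ceiling_weight l = (if l \<le> 1 then 5 else 6)"

definition rich_hubs :: "nat \<Rightarrow> nat set set \<Rightarrow> real" where
  "rich_hubs j = hub_sum (\<lambda>l. of_bool (j \<le> l))"

lemma hub_sum_nonneg: "(\<And>l. 0 \<le> g l) \<Longrightarrow> 0 \<le> hub_sum g G"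
  by (simp add: hub_sum_def sum_nonneg)

lemma ceiling_weight_nonneg: "0 \<le> ceiling_weight l"
  by (simp add: ceiling_weight_def)

lemma growth_weight_nonneg: "0 \<le> growth_weight l"
  by (simp add: growth_weight_def)

lemma rich_hubs_nonneg: "0 \<le> rich_hubs j G"
  by (simp add: rich_hubs_def hub_sum_nonneg)

text \<open>A bound that is linear in the jump, so that a lower bound for the mean jump becomes an upper bound for the mean
  reciprocal.\<close>

lemma inverse_increment:
  fixes S D :: real
  assumes "0 < S" "0 \<le> D" "D \<le> 3"
  shows "1 / (S + D) \<le> 1 / S - D / (S * (S + 3))"
proof -
  have "D / (S * (S + 3)) \<le> D / (S * (S + D))"
    using assms by (intro divide_left_mono mult_left_mono mult_pos_pos) auto
  also have "\<dots> = 1 / S - 1 / (S + D)"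
    using assms by (simp add: field_simps)
  finally show ?thesis by simp
qed

context friend_graph
begin

text \<open>The conditional mean of a function of a sum over hubs, as a sum over the hubs: the first summand
  is the case that the hub receives the new vertex, the second that one of its leaves does.\<close>

lemma step_mean_hub_sum:
  "real n * step_mean n G (\<lambda>H. F (hub_sum g H)) =
    (\<Sum>v\<in>hubs G. attach_weight G v * F (hub_sum g G + g (Suc (leaf_count G v)) - g (leaf_count G v)) +
      real (leaf_count G v) / real (vertex_degree G v) * 
        F (hub_sum g G + g 1 + g (leaf_count G v - 1) - g (leaf_count G v)))"
proof -
  have "real n * step_mean n G (\<lambda>H. F (hub_sum g H)) =
      (\<Sum>w\<in>{1..n}. attach_weight G w * F (hub_sum g (insert {Suc n, w} G)))"
    using size by (simp add: step_mean_def)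
  also have "\<dots> = (\<Sum>v\<in>hubs G. attach_weight G v * F (hub_sum g (insert {Suc n, v} G)) +
      (\<Sum>w\<in>leaf_nbrs G v. F (hub_sum g (insert {Suc n, w} G))) / real (vertex_degree G v))"
    by (rule sum_attach_weight)
  also have "\<dots> = (\<Sum>v\<in>hubs G. attach_weight G v * F (hub_sum g G + g (Suc (leaf_count G v)) - g (leaf_count G v)) +
      real (leaf_count G v) / real (vertex_degree G v) * 
        F (hub_sum g G + g 1 + g (leaf_count G v - 1) - g (leaf_count G v)))"
  proof (rule sum.cong[OF refl])
    fix v assume v: "v \<in> hubs G"
    then have 1: "hub_sum g (insert {Suc n, v} G) = hub_sum g G + g (Suc (leaf_count G v)) - g (leaf_count G v)"
      using hubs_subset by (intro hub_sum_attach_hub) auto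
    have "hub_sum g (insert {Suc n, w} G) = hub_sum g G + g 1 + g (leaf_count G v - 1) - g (leaf_count G v)"
      if "w \<in> leaf_nbrs G v" for w
      by (rule hub_sum_attach_leaf[OF leaf_nbrsD(3)[OF that] that])
    then show "attach_weight G v * F (hub_sum g (insert {Suc n, v} G)) +
      (\<Sum>w\<in>leaf_nbrs G v. F (hub_sum g (insert {Suc n, w} G))) / real (vertex_degree G v) =
      attach_weight G v * F (hub_sum g G + g (Suc (leaf_count G v)) - g (leaf_count G v)) +
      real (leaf_count G v) / real (vertex_degree G v) * 
        F (hub_sum g G + g 1 + g (leaf_count G v - 1) - g (leaf_count G v))"
      unfolding 1 by (simp add: leaf_count_def)
  qed
  finally show ?thesis .
qed

lemma attach_weight_nonneg: "0 \<le> attach_weight G w"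
  by (simp add: attach_weight_def sum_nonneg)

lemma leaf_fraction:
  assumes "v \<in> hubs G"
  defines "x \<equiv> real (leaf_count G v) / real (vertex_degree G v)"
  shows "0 \<le> x" "x \<le> 1" "leaf_count G v = 1 \<Longrightarrow> x \<le> 1 / 2"
  using assms leaf_count_le[of v] by (auto simp: hubs_def field_simps)

text \<open>New hubs appear at rate $\sum_v l(v)/d(v)$ and bring weight 5 each.  Weight is otherwise gained only when
  a hub with one leaf is chosen; its rate is 1 through its leaf plus the rate through other hubs.  Summed over
  all hubs, the latter rates make up $\sum_v (1 - l(v)/d(v))$.  A hub thus contributes at most
  $1 + 4 l(v)/d(v)$, increased by one if $l(v) = 1$, and this is at most 5/6 of its weight.\<close>

lemma step_mean_ceiling:
  "step_mean n G (hub_sum ceiling_weight) \<le> (1 + 5 / 6 / real n) * hub_sum ceiling_weight G"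
proof -
  let ?S = "hub_sum ceiling_weight G" and ?l = "leaf_count G" and ?a = "attach_weight G"
  let ?x = "\<lambda>v. real (leaf_count G v) / real (vertex_degree G v)"
  have n: "(\<Sum>v\<in>hubs G. 1 + real (?l v)) = (\<Sum>v\<in>hubs G. ?a v + ?x v)"
    by (simp only: sum_leaf_count sum_attach_weight_total)
  have "real n * step_mean n G (hub_sum ceiling_weight) =
      (\<Sum>v\<in>hubs G. ?a v * (?S + ceiling_weight (Suc (?l v)) - ceiling_weight (?l v)) +
        ?x v * (?S + ceiling_weight 1 + ceiling_weight (?l v - 1) - ceiling_weight (?l v)))"
    using step_mean_hub_sum[of "\<lambda>x. x" ceiling_weight] by simp
  also have "\<dots> \<le> (\<Sum>v\<in>hubs G. ((?a v + ?x v) * ?S + (?a v - real (?l v))) + (of_bool (?l v = 1) + 5 * ?x v))"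
  proof (rule sum_mono)
    fix v assume v: "v \<in> hubs G"
    have "?a v * (ceiling_weight (Suc (?l v)) - ceiling_weight (?l v)) \<le> ?a v - real (?l v) + of_bool (?l v = 1)"
      using attach_weight_ge[of v] by (auto simp: ceiling_weight_def)
    moreover have "?x v * (ceiling_weight 1 + ceiling_weight (?l v - 1) - ceiling_weight (?l v)) \<le> ?x v * 5"
      using leaf_fraction(1)[OF v] by (intro mult_left_mono) (auto simp: ceiling_weight_def)
    ultimately show "?a v * (?S + ceiling_weight (Suc (?l v)) - ceiling_weight (?l v)) +
        ?x v * (?S + ceiling_weight 1 + ceiling_weight (?l v - 1) - ceiling_weight (?l v)) \<le>
        ((?a v + ?x v) * ?S + (?a v - real (?l v))) + (of_bool (?l v = 1) + 5 * ?x v)"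
      by (simp add: algebra_simps)
  qed
  also have "\<dots> = (\<Sum>v\<in>hubs G. (?a v + ?x v) * ?S + (1 + of_bool (?l v = 1) + 4 * ?x v) +
      ((?a v + ?x v) - (1 + real (?l v))))"
    by (intro sum.cong refl) (simp add: algebra_simps)
  also have "\<dots> = (\<Sum>v\<in>hubs G. (?a v + ?x v) * ?S) + (\<Sum>v\<in>hubs G. 1 + of_bool (?l v = 1) + 4 * ?x v) +
      ((\<Sum>v\<in>hubs G. ?a v + ?x v) - (\<Sum>v\<in>hubs G. 1 + real (?l v)))"
    by (simp only: sum.distrib sum_subtractf)
  also have "\<dots> = (\<Sum>v\<in>hubs G. ?a v + ?x v) * ?S + (\<Sum>v\<in>hubs G. 1 + of_bool (?l v = 1) + 4 * ?x v)"
    unfolding n by (simp add: sum_distrib_right)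
  also have "\<dots> \<le> real n * ?S + (\<Sum>v\<in>hubs G. 5 / 6 * ceiling_weight (?l v))"
  proof (intro add_mono sum_mono)
    fix v assume v: "v \<in> hubs G"
    show "1 + of_bool (?l v = 1) + 4 * ?x v \<le> 5 / 6 * ceiling_weight (?l v)"
    proof -
      consider "?l v = 0" | "?l v = 1" | "2 \<le> ?l v" by linarith
      then show ?thesis
      proof cases
        case 1
        then show ?thesis by (simp add: ceiling_weight_def)
      next
        case 2
        then have "ceiling_weight (?l v) = 5" "?x v \<le> 1 / 2"
          using leaf_fraction(3)[OF v] by (simp_all add: ceiling_weight_def)
        moreover have "of_bool (?l v = 1) = (1 :: real)" using 2 by simp
        ultimately show ?thesis by linarith
      next
        case 3
        then have "ceiling_weight (?l v) = 6" "?x v \<le> 1"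
          using leaf_fraction(2)[OF v] by (simp_all add: ceiling_weight_def)
        moreover have "of_bool (?l v = 1) = (0 :: real)" using 3 by simp
        ultimately show ?thesis by linarith
      qed
    qed
  qed (simp add: sum_attach_weight_total)
  also have "(\<Sum>v\<in>hubs G. 5 / 6 * ceiling_weight (?l v)) = 5 / 6 * ?S"
    by (simp add: hub_sum_def sum_distrib_left)
  finally show ?thesis
    using size by (simp add: field_simps)
qed

text \<open>The estimate fails for single hubs: a hub with a few leaves and many hub neighbours
  contributes too little.  It holds hub by hub after adding $(d(v) - l(v) - 2)/4$, where $d(v) - l(v)$ is the
  number of adjacent hubs, and the sum of these corrections is at most 0 by \<open>hub_edges\<close>.\<close>

lemma growth_weight_drift:
  "hub_sum growth_weight G / 4 \<le>
    (\<Sum>v\<in>hubs G. attach_weight G v * (growth_weight (Suc (leaf_count G v)) - growth_weight (leaf_count G v)) +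
      real (leaf_count G v) / real (vertex_degree G v) *
        (growth_weight 1 + growth_weight (leaf_count G v - 1) - growth_weight (leaf_count G v)))"
    (is "_ \<le> sum ?D _")
proof -
  let ?d = "vertex_degree G" and ?l = "leaf_count G"
  have "growth_weight (?l v) / 4 \<le> ?D v + (real (?d v) - real (?l v) - 2) / 4" if v: "v \<in> hubs G" for v
  proof -
    have d: "real (?d v) \<ge> 2" using v by (simp add: hubs_def)
    have l: "real (?l v) \<le> real (?d v)" using leaf_count_le[of v] by simp
    have a: "real (?l v) \<le> attach_weight G v" by (rule attach_weight_ge)
    consider "?l v = 0" | "?l v = 1" | "?l v = 2" | "3 \<le> ?l v" by linarith
    then show ?thesis
    proof cases
      case 1
      then show ?thesis using d a by (simp add: growth_weight_def)
    next
      case 2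
      then have D: "?D v = attach_weight G v" and g: "growth_weight (?l v) = 3" and l1: "real (?l v) = 1"
        by (simp_all add: growth_weight_def)
      have "1 \<le> attach_weight G v" using a l1 by simp
      with d show ?thesis unfolding D unfolding g l1 by (simp add: field_simps)
    next
      case 3
      \<comment> \<open>This is $4/d + d/4 \<ge> 2$.\<close>
      have "0 \<le> (real (?d v) - 4)\<^sup>2" by simp
      with 3 d show ?thesis
        by (simp add: growth_weight_def field_simps power2_eq_square)
    next
      case 4
      define i where "i = real (?d v) - real (?l v)"
      have i: "0 \<le> i" and di: "real (?d v) = real (?l v) + i" using l by (auto simp: i_def)
      have "3 / (3 + i) \<le> real (?l v) / real (?d v)"
        unfolding di using 4 i mult_right_mono[of 3 "real (?l v)" i] by (simp add: field_simps)
      moreover have "7 / 4 \<le> 3 * (3 / (3 + i)) + (i - 2) / 4"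
      proof -
        \<comment> \<open>This is $9/(3+i) + (3+i)/4 \<ge> 3$, by the arithmetic-geometric mean inequality.\<close>
        have "0 \<le> (i - 3)\<^sup>2" by simp
        with i show ?thesis by (simp add: field_simps power2_eq_square)
      qed
      ultimately have "1 \<le> 3 * (real (?l v) / real (?d v)) + (i - 2) / 4" by linarith
      moreover have "growth_weight (Suc (?l v)) = 4" "growth_weight (?l v) = 4" "growth_weight (?l v - 1) = 4"
        using 4 by (auto simp: growth_weight_def)
      moreover have "growth_weight (Suc 0) = 3"
        by (simp add: growth_weight_def)
      ultimately show ?thesis by (simp add: i_def)
    qed
  qed
  then have "(\<Sum>v\<in>hubs G. growth_weight (?l v) / 4) \<le>
      (\<Sum>v\<in>hubs G. ?D v + (real (?d v) - real (?l v) - 2) / 4)"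
    by (rule sum_mono)
  also have "\<dots> = sum ?D (hubs G) + ((\<Sum>v\<in>hubs G. real (?d v) - real (?l v)) - 2 * real (card (hubs G))) / 4"
    by (simp add: sum.distrib sum_subtractf sum_divide_distrib[symmetric])
  also have "\<dots> \<le> sum ?D (hubs G)"
    using hub_edges by simp
  finally show ?thesis
    by (simp add: hub_sum_def sum_divide_distrib)
qed

text \<open>The total weight $S$ has drift at least $S/(4n)$ and jumps of at most 3, so that the mean of its
  reciprocal drops by at least $1/(4n(S+3))$.  For $S \<ge> 4$ this is at least $1/(7nS)$.\<close>

lemma step_mean_growth:
  assumes S: "4 \<le> hub_sum growth_weight G"
  shows "step_mean n G (\<lambda>H. 1 / hub_sum growth_weight H) \<le>
    (1 - 1 / (7 * real n)) * (1 / hub_sum growth_weight G)"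
proof -
  define S where "S = hub_sum growth_weight G"
  have S4: "4 \<le> S" using S by (simp add: S_def)
  let ?l = "leaf_count G" and ?a = "attach_weight G"
  let ?x = "\<lambda>v. real (leaf_count G v) / real (vertex_degree G v)"
  let ?D1 = "\<lambda>v. growth_weight (Suc (?l v)) - growth_weight (?l v)"
  let ?D2 = "\<lambda>v. growth_weight 1 + growth_weight (?l v - 1) - growth_weight (?l v)"
  have D: "0 \<le> ?D1 v" "?D1 v \<le> 3" "0 \<le> ?D2 v" "?D2 v \<le> 3" for v
    by (auto simp: growth_weight_def)
  have "real n * step_mean n G (\<lambda>H. 1 / hub_sum growth_weight H) =
      (\<Sum>v\<in>hubs G. ?a v * (1 / (S + ?D1 v)) + ?x v * (1 / (S + ?D2 v)))"
    unfolding step_mean_hub_sum[of "\<lambda>x. 1 / x" growth_weight] S_def by (simp add: algebra_simps)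
  also have "\<dots> \<le> (\<Sum>v\<in>hubs G. ?a v * (1 / S - ?D1 v / (S * (S + 3))) + ?x v * (1 / S - ?D2 v / (S * (S + 3))))"
    using S4 D leaf_fraction(1) attach_weight_nonneg
    by (intro sum_mono add_mono mult_left_mono inverse_increment) auto
  also have "\<dots> = (\<Sum>v\<in>hubs G. (?a v + ?x v) * (1 / S) - (?a v * ?D1 v + ?x v * ?D2 v) / (S * (S + 3)))"
    by (intro sum.cong refl) (simp add: algebra_simps add_divide_distrib diff_divide_distrib)
  also have "\<dots> = (\<Sum>v\<in>hubs G. ?a v + ?x v) * (1 / S) - (\<Sum>v\<in>hubs G. ?a v * ?D1 v + ?x v * ?D2 v) / (S * (S + 3))"
    by (simp only: sum_subtractf sum_distrib_right sum_divide_distrib)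
  also have "\<dots> \<le> real n * (1 / S) - S / 4 / (S * (S + 3))"
    unfolding sum_attach_weight_total using growth_weight_drift S4
    by (intro diff_left_mono divide_right_mono) (auto simp: S_def)
  also have "\<dots> \<le> real n * (1 / S) - 1 / (7 * S)"
  proof -
    have "1 / (7 * S) \<le> 1 / (4 * (S + 3))"
      using S4 by (intro divide_left_mono) auto
    also have "\<dots> = S / 4 / (S * (S + 3))"
      using S4 by simp
    finally show ?thesis by simp
  qed
  also have "\<dots> = real n * ((1 - 1 / (7 * real n)) * (1 / S))"
    using S4 size by (simp add: field_simps)
  finally have "real n * step_mean n G (\<lambda>H. 1 / hub_sum growth_weight H) \<le>
    real n * ((1 - 1 / (7 * real n)) * (1 / S))" .
  then show ?thesis
    using size unfolding S_def by (subst (asm) mult_le_cancel_left_pos) auto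
qed

text \<open>An upward jump halves $2^{-Z}$ and a downward jump doubles it.  The former occurs with weight at
  least 1 for every hub with exactly \<open>j\<close> leaves, the latter with weight at most 1 for every
  hub with exactly \<open>j + 1\<close> leaves.\<close>

lemma step_mean_rich:
  assumes j: "1 \<le> j"
  shows "step_mean n G (\<lambda>H. 2 powr - rich_hubs (Suc j) H) \<le>
    (1 - (rich_hubs j G - 3 * rich_hubs (Suc j) G) / (2 * real n)) * 2 powr - rich_hubs (Suc j) G"
proof -
  define g :: "nat \<Rightarrow> real" where "g = (\<lambda>l. of_bool (Suc j \<le> l))"
  define S where "S = hub_sum g G"
  have S: "rich_hubs (Suc j) = hub_sum g" by (simp add: g_def rich_hubs_def fun_eq_iff)
  let ?l = "leaf_count G" and ?a = "attach_weight G"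
  let ?x = "\<lambda>v. real (leaf_count G v) / real (vertex_degree G v)"
  let ?P = "\<lambda>m. of_bool (m \<le> 0)"
  have "real n * step_mean n G (\<lambda>H. 2 powr - hub_sum g H) =
      (\<Sum>v\<in>hubs G. ?a v * 2 powr - (S + g (Suc (?l v)) - g (?l v)) +
        ?x v * 2 powr - (S + g 1 + g (?l v - 1) - g (?l v)))"
    unfolding step_mean_hub_sum[of "\<lambda>x. 2 powr - x" g] S_def by simp
  also have "\<dots> \<le> (\<Sum>v\<in>hubs G. ((?a v + ?x v) - (of_bool (j \<le> ?l v) - 3 * g (?l v)) / 2) * 2 powr - S)"
  proof (rule sum_mono)
    fix v assume v: "v \<in> hubs G"
    have a: "real (?l v) \<le> ?a v" by (rule attach_weight_ge)
    define x where "x = ?x v"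
    have x: "0 \<le> x" "x \<le> 1" using leaf_fraction[OF v] by (auto simp: x_def)
    have g1: "g 1 = 0" using j by (simp add: g_def)
    have e: "2 powr - (S + u + w - z) = 2 powr (z - u - w) * 2 powr - S" for u w z :: real
      by (simp add: powr_add[symmetric] algebra_simps)
    have e': "2 powr - (S + u - z) = 2 powr (z - u) * 2 powr - S" for u z :: real
      by (simp add: powr_add[symmetric] algebra_simps)
    have "?a v * 2 powr (g (?l v) - g (Suc (?l v))) + x * 2 powr (g (?l v) - g 1 - g (?l v - 1)) \<le>
        (?a v + x) - (of_bool (j \<le> ?l v) - 3 * g (?l v)) / 2"
    proof -
      consider "?l v < j" | "?l v = j" | "?l v = Suc j" | "Suc j < ?l v" by linarith
      then show ?thesis
      proof cases
        case 1
        then have "g (?l v) = 0" "g (Suc (?l v)) = 0" "g (?l v - 1) = 0" "\<not> j \<le> ?l v"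
          by (auto simp: g_def)
        then show ?thesis using g1 by simp
      next
        case 2
        then have "g (?l v) = 0" "g (Suc (?l v)) = 1" "g (?l v - 1) = 0" "j \<le> ?l v" "1 \<le> real (?l v)"
          using j by (auto simp: g_def)
        then show ?thesis using g1 a by (simp add: powr_minus)
      next
        case 3
        then have "g (?l v) = 1" "g (Suc (?l v)) = 1" "g (?l v - 1) = 0" "j \<le> ?l v"
          using j by (auto simp: g_def)
        then show ?thesis using g1 x by simp
      next
        case 4
        then have "g (?l v) = 1" "g (Suc (?l v)) = 1" "g (?l v - 1) = 1" "j \<le> ?l v"
          using j by (auto simp: g_def)
        then show ?thesis using g1 x by simp
      qed
    qed
    from mult_right_mono[OF this, of "2 powr - S"]
    show "?a v * 2 powr - (S + g (Suc (?l v)) - g (?l v)) +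
        ?x v * 2 powr - (S + g 1 + g (?l v - 1) - g (?l v)) \<le>
        ((?a v + ?x v) - (of_bool (j \<le> ?l v) - 3 * g (?l v)) / 2) * 2 powr - S"
      unfolding e e' x_def[symmetric] by (simp add: algebra_simps)
  qed
  also have "\<dots> = ((\<Sum>v\<in>hubs G. ?a v + ?x v) - (\<Sum>v\<in>hubs G. of_bool (j \<le> ?l v) - 3 * g (?l v)) / 2) * 2 powr - S"
    by (simp only: sum_distrib_right[symmetric] sum_subtractf[symmetric] sum_divide_distrib)
  also have "(\<Sum>v\<in>hubs G. of_bool (j \<le> ?l v) - 3 * g (?l v)) = rich_hubs j G - 3 * S"
    by (simp add: rich_hubs_def hub_sum_def S_def sum_subtractf sum_distrib_left)
  finally show ?thesis
    unfolding sum_attach_weight_total S S_def[symmetric]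
    using size by (simp add: field_simps)
qed

lemma hub_sum_growth_attach:
  assumes "w \<in> {1..n}"
  shows "hub_sum growth_weight G \<le> hub_sum growth_weight (insert {Suc n, w} G)"
  using assms
proof (cases rule: attach_cases)
  case 1
  from hub_sum_attach_hub[OF assms this, of growth_weight] show ?thesis
    by (simp add: growth_weight_def)
next
  case (2 p)
  from hub_sum_attach_leaf[OF assms this, of growth_weight] show ?thesis
    by (auto simp: growth_weight_def split: if_splits)
qed

lemma card_hubs_le_ceiling: "real (card (hubs G)) \<le> hub_sum ceiling_weight G"
  unfolding hub_sum_def using sum_mono[of "hubs G" "\<lambda>_. 1" "\<lambda>v. ceiling_weight (leaf_count G v)"]
  by (auto simp: ceiling_weight_def)

lemma growth_le_rich: "hub_sum growth_weight G \<le> 4 * rich_hubs 1 G"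
  unfolding hub_sum_def rich_hubs_def sum_distrib_left
  by (rule sum_mono) (auto simp: growth_weight_def)

lemma rich_hubs_le: "rich_hubs j G \<le> real (card {v \<in> {1..n}. j \<le> vertex_degree G v})"
proof -
  have "rich_hubs j G = real (card {v \<in> hubs G. j \<le> leaf_count G v})"
    using finite_hubs by (simp add: rich_hubs_def hub_sum_def of_bool_def sum.If_cases Int_def)
  also have "\<dots> \<le> real (card {v \<in> {1..n}. j \<le> vertex_degree G v})"
  proof (intro of_nat_mono card_mono subsetI)
    fix v assume "v \<in> {v \<in> hubs G. j \<le> leaf_count G v}"
    then show "v \<in> {v \<in> {1..n}. j \<le> vertex_degree G v}"
      using hubs_subset leaf_count_le[of v] by auto
  qed simp
  finally show ?thesis .
qed

lemma rich_hubs_le_size: "rich_hubs j G \<le> real n"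
proof -
  have "card {v \<in> {1..n}. j \<le> vertex_degree G v} \<le> card {1..n}"
    by (rule card_mono) auto
  with rich_hubs_le[of j] show ?thesis by simp
qed

text \<open>While at most \<open>b / 4\<close> hubs have more than \<open>j\<close> leaves, the gain dominates and the mean contracts;
  otherwise $2^{-Z}$ is already below $2^{-b/4}$, and one step cannot more than triple it on average.\<close>

lemma step_mean_rich_le:
  assumes j: "1 \<le> j" and b: "0 \<le> b" "b \<le> rich_hubs j G"
  shows "step_mean n G (\<lambda>H. 2 powr - rich_hubs (Suc j) H) \<le>
    (1 - b / (8 * real n)) * 2 powr - rich_hubs (Suc j) G + 3 * 2 powr - (b / 4)"
proof -
  define Z where "Z = rich_hubs (Suc j) G"
  have Z: "0 \<le> Z" "Z \<le> real n"
    using rich_hubs_nonneg rich_hubs_le_size by (auto simp: Z_def)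
  have n: "0 < real n" using size by simp
  have bn: "b \<le> real n" using b(2) rich_hubs_le_size[of j] by simp
  have p: "0 \<le> (1 - b / (8 * real n)) * 2 powr - Z"
    using bn n by (intro mult_nonneg_nonneg) simp_all
  have "(1 - (rich_hubs j G - 3 * Z) / (2 * real n)) * 2 powr - Z \<le>
    (1 - b / (8 * real n)) * 2 powr - Z + 3 * 2 powr - (b / 4)"
  proof (cases "Z \<le> b / 4")
    case True
    then have "1 - (rich_hubs j G - 3 * Z) / (2 * real n) \<le> 1 - b / (8 * real n)"
    proof -
      have "b / 4 / (2 * real n) \<le> (rich_hubs j G - 3 * Z) / (2 * real n)"
        using b True by (intro divide_right_mono) auto
      then show ?thesis by simp
    qed
    then have "(1 - (rich_hubs j G - 3 * Z) / (2 * real n)) * 2 powr - Z \<le> (1 - b / (8 * real n)) * 2 powr - Z"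
      by (rule mult_right_mono) simp
    then show ?thesis by (simp add: add_increasing2)
  next
    case False
    have "1 - (rich_hubs j G - 3 * Z) / (2 * real n) \<le> 3"
    proof -
      have "(- 3 * real n) / (2 * real n) \<le> (rich_hubs j G - 3 * Z) / (2 * real n)"
        using rich_hubs_nonneg[of j G] Z by (intro divide_right_mono) auto
      moreover have "(- 3 * real n) / (2 * real n) = - (3 / 2)" using n by simp
      ultimately show ?thesis by linarith
    qed
    then have "(1 - (rich_hubs j G - 3 * Z) / (2 * real n)) * 2 powr - Z \<le> 3 * 2 powr - Z"
      by (rule mult_right_mono) simp
    also have "\<dots> \<le> 3 * 2 powr - (b / 4)"
      using False by (intro mult_left_mono powr_mono) auto
    finally show ?thesis using p by simp
  qed
  with step_mean_rich[OF j] show ?thesis by (simp add: Z_def)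
qed

end

section \<open>The law of one step\<close>

text \<open>The choices before time \<open>n\<close> have a discrete law.  Finite lists are countable, so that
  this law determines the integral of every function of these choices.\<close>

primrec history_pmf :: "nat \<Rightarrow> (nat \<times> nat) list pmf" where
  "history_pmf 0 = return_pmf []"
| "history_pmf (Suc n) =
     bind_pmf (history_pmf n) (\<lambda>xs. map_pmf (\<lambda>p. xs @ [p]) (friend_step n ((!) xs)))"

lemma length_history: "xs \<in> set_pmf (history_pmf n) \<Longrightarrow> length xs = n"
  by (induction n arbitrary: xs) auto

lemma emeasure_history_pmf:
  assumes "length xs = n"
  shows "emeasure (history_pmf n) {xs} = (\<Prod>i<n. ennreal (pmf (friend_step i ((!) xs)) (xs ! i)))"
  using assms
proof (induction n arbitrary: xs)
  case (Suc n)
  then obtain ys y where xs: "xs = ys @ [y]" and ys: "length ys = n"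
    by (metis length_Suc_conv_rev)
  have "emeasure (history_pmf (Suc n)) {xs} =
      (\<integral>\<^sup>+zs. emeasure (map_pmf (\<lambda>p. zs @ [p]) (friend_step n ((!) zs))) {xs} \<partial>history_pmf n)"
    by (simp add: emeasure_bind_pmf)
  also have "\<dots> = (\<integral>\<^sup>+zs. ennreal (pmf (friend_step n ((!) ys)) y) * indicator {ys} zs \<partial>history_pmf n)"
  proof (rule nn_integral_cong)
    fix zs
    have "(\<lambda>p. zs @ [p]) -` {xs} = (if zs = ys then {y} else {})"
      by (auto simp: xs)
    then show "emeasure (map_pmf (\<lambda>p. zs @ [p]) (friend_step n ((!) zs))) {xs} =
        ennreal (pmf (friend_step n ((!) ys)) y) * indicator {ys} zs"
      by (simp only: emeasure_map_pmf) (simp add: emeasure_pmf_single)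
  qed
  also have "\<dots> = ennreal (pmf (friend_step n ((!) ys)) y) * emeasure (history_pmf n) {ys}"
    by (simp add: nn_integral_cmult_indicator)
  also have "\<dots> = ennreal (pmf (friend_step n ((!) xs)) (xs ! n)) *
      (\<Prod>i<n. ennreal (pmf (friend_step i ((!) xs)) (xs ! i)))"
  proof -
    have "friend_step i ((!) ys) = friend_step i ((!) xs)" if "i \<le> n" for i
      by (rule friend_step_cong) (use that ys xs in \<open>simp add: nth_append\<close>)
    then show ?thesis
      unfolding Suc.IH[OF ys] using ys xs by (auto simp: nth_append intro!: prod.cong)
  qed
  finally show ?case by (simp add: mult.commute)
qed (simp add: emeasure_pmf_single)

lemma measurable_friend_process_component:
  "(\<lambda>\<omega>. \<omega> i) \<in> friend_process \<rightarrow>\<^sub>M count_space UNIV"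
  by (simp add: measurable_cong_sets[OF sets_friend_process refl])

lemma measurable_history:
  "(\<lambda>\<omega>. map \<omega> [0..<n]) \<in> friend_process \<rightarrow>\<^sub>M count_space UNIV"
proof (induction n)
  case (Suc n)
  have "(\<lambda>\<omega>. map \<omega> [0..<n] @ [\<omega> n]) \<in> friend_process \<rightarrow>\<^sub>M count_space UNIV"
    by (rule measurable_compose_countable[where f = "\<lambda>p \<omega>. map \<omega> [0..<n] @ [p]" and g = "\<lambda>\<omega>. \<omega> n"])
      (auto intro: measurable_friend_process_component measurable_compose[OF Suc])
  then show ?case by simp
qed simp

lemma distr_history: "distr friend_process (count_space UNIV) (\<lambda>\<omega>. map \<omega> [0..<n]) = history_pmf n"
proof (rule measure_eqI_countable[where A = UNIV])
  fix xs :: "(nat \<times> nat) list"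
  have *: "emeasure (distr friend_process (count_space UNIV) (\<lambda>\<omega>. map \<omega> [0..<n])) {xs} =
      emeasure friend_process {\<omega>. map \<omega> [0..<n] = xs}"
    by (subst emeasure_distr) (auto simp: measurable_history space_friend_process vimage_def)
  show "emeasure (distr friend_process (count_space UNIV) (\<lambda>\<omega>. map \<omega> [0..<n])) {xs} =
      emeasure (history_pmf n) {xs}"
  proof (cases "length xs = n")
    case True
    then have "{\<omega>. map \<omega> [0..<n] = xs} = {\<omega>. \<forall>i<n. \<omega> i = xs ! i}"
      by (auto simp: list_eq_iff_nth_eq)
    then show ?thesis
      by (simp only: * emeasure_friend_process_cylinder emeasure_history_pmf[OF True])
  next
    case False
    then have e: "{\<omega>. map \<omega> [0..<n] = xs} = {}"
      by auto
    have "xs \<notin> set_pmf (history_pmf n)"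
      using False length_history by blast
    then show ?thesis
      by (simp only: * e emeasure_pmf_single) (simp add: pmf_eq_0_set_pmf)
  qed
qed auto

lemma history_function:
  assumes "\<And>\<omega> \<omega>'. (\<And>i. i < n \<Longrightarrow> \<omega> i = \<omega>' i) \<Longrightarrow> f \<omega> = f \<omega>'"
  shows "f \<omega> = f ((!) (map \<omega> [0..<n]))"
  by (rule assms) simp

lemma measurable_history_function:
  assumes "\<And>\<omega> \<omega>'. (\<And>i. i < n \<Longrightarrow> \<omega> i = \<omega>' i) \<Longrightarrow> f \<omega> = f \<omega>'"
  shows "f \<in> friend_process \<rightarrow>\<^sub>M count_space UNIV"
proof -
  have "(\<lambda>\<omega>. f ((!) (map \<omega> [0..<n]))) \<in> friend_process \<rightarrow>\<^sub>M count_space UNIV"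
    by (rule measurable_compose[OF measurable_history]) simp
  also have "(\<lambda>\<omega>. f ((!) (map \<omega> [0..<n]))) = f"
    using history_function[of n f] assms by (intro ext) (metis (no_types, lifting))
  finally show ?thesis .
qed

lemma borel_measurable_history_function:
  fixes f :: "_ \<Rightarrow> 'b :: topological_space"
  assumes "\<And>\<omega> \<omega>'. (\<And>i. i < n \<Longrightarrow> \<omega> i = \<omega>' i) \<Longrightarrow> f \<omega> = f \<omega>'"
  shows "f \<in> borel_measurable friend_process"
  using measurable_compose[OF measurable_history_function[of n f, OF assms], of "\<lambda>x. x" borel]
  by simp

lemma nn_integral_history:
  fixes f :: "_ \<Rightarrow> ennreal"
  assumes "\<And>\<omega> \<omega>'. (\<And>i. i < n \<Longrightarrow> \<omega> i = \<omega>' i) \<Longrightarrow> f \<omega> = f \<omega>'"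
  shows "(\<integral>\<^sup>+\<omega>. f \<omega> \<partial>friend_process) = (\<integral>\<^sup>+xs. f ((!) xs) \<partial>history_pmf n)"
proof -
  have "(\<integral>\<^sup>+\<omega>. f \<omega> \<partial>friend_process) = (\<integral>\<^sup>+\<omega>. f ((!) (map \<omega> [0..<n])) \<partial>friend_process)"
    by (intro nn_integral_cong history_function assms)
  also have "\<dots> = (\<integral>\<^sup>+xs. f ((!) xs) \<partial>distr friend_process (count_space UNIV) (\<lambda>\<omega>. map \<omega> [0..<n]))"
    by (rule nn_integral_distr[symmetric]) (auto simp: measurable_history)
  finally show ?thesis by (simp only: distr_history)
qed

text \<open>The Markov property in integrated form: given the choices before time \<open>n\<close>, the next one may be
  averaged over \<open>friend_step\<close>.\<close>

lemma nn_integral_friend_step: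
  fixes h :: "_ \<Rightarrow> _ \<Rightarrow> ennreal"
  assumes "\<And>\<omega> \<omega>' p. (\<And>i. i < n \<Longrightarrow> \<omega> i = \<omega>' i) \<Longrightarrow> h \<omega> p = h \<omega>' p"
  shows "(\<integral>\<^sup>+\<omega>. h \<omega> (\<omega> n) \<partial>friend_process) =
    (\<integral>\<^sup>+\<omega>. (\<integral>\<^sup>+p. h \<omega> p \<partial>friend_step n \<omega>) \<partial>friend_process)"
proof -
  have "(\<integral>\<^sup>+\<omega>. h \<omega> (\<omega> n) \<partial>friend_process) = (\<integral>\<^sup>+xs. h ((!) xs) (xs ! n) \<partial>history_pmf (Suc n))"
  proof (rule nn_integral_history)
    fix \<omega> \<omega>' :: "nat \<Rightarrow> nat \<times> nat" assume "\<And>i. i < Suc n \<Longrightarrow> \<omega> i = \<omega>' i"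
    then show "h \<omega> (\<omega> n) = h \<omega>' (\<omega>' n)" using assms[of \<omega> \<omega>'] by simp
  qed
  also have "\<dots> = (\<integral>\<^sup>+xs. (\<integral>\<^sup>+p. h ((!) (xs @ [p])) ((xs @ [p]) ! n) \<partial>friend_step n ((!) xs)) \<partial>history_pmf n)"
    by simp
  also have "\<dots> = (\<integral>\<^sup>+xs. (\<integral>\<^sup>+p. h ((!) xs) p \<partial>friend_step n ((!) xs)) \<partial>history_pmf n)"
  proof (rule nn_integral_cong_AE, rule AE_pmfI, rule nn_integral_cong)
    fix xs p assume "xs \<in> set_pmf (history_pmf n)"
    then have "length xs = n" by (rule length_history)
    then show "h ((!) (xs @ [p])) ((xs @ [p]) ! n) = h ((!) xs) p"
      using assms[of "(!) (xs @ [p])" "(!) xs" p] by (simp add: nth_append)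
  qed
  also have "\<dots> = (\<integral>\<^sup>+\<omega>. (\<integral>\<^sup>+p. h \<omega> p \<partial>friend_step n \<omega>) \<partial>friend_process)"
  proof (rule nn_integral_history[symmetric])
    fix \<omega> \<omega>' :: "nat \<Rightarrow> nat \<times> nat" assume eq: "\<And>i. i < n \<Longrightarrow> \<omega> i = \<omega>' i"
    then show "(\<integral>\<^sup>+p. h \<omega> p \<partial>friend_step n \<omega>) = (\<integral>\<^sup>+p. h \<omega>' p \<partial>friend_step n \<omega>')"
      using assms[of \<omega> \<omega>'] friend_step_cong[of n \<omega> \<omega>'] by simp
  qed
  finally show ?thesis .
qed

text \<open>Almost every history makes only possible choices; this is what keeps the graph a tree.\<close>

lemma AE_friend_step_support:
  "AE \<omega> in friend_process. \<forall>n. \<omega> n \<in> set_pmf (friend_step n \<omega>)"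
  unfolding AE_all_countable
proof
  fix n
  have "(\<integral>\<^sup>+\<omega>. indicator (- set_pmf (friend_step n \<omega>)) (\<omega> n) \<partial>friend_process) =
      (\<integral>\<^sup>+\<omega>. (\<integral>\<^sup>+p. indicator (- set_pmf (friend_step n \<omega>)) p \<partial>friend_step n \<omega>) \<partial>friend_process)"
    by (rule nn_integral_friend_step) (metis friend_step_cong)
  also have "\<dots> = (\<integral>\<^sup>+\<omega>. 0 \<partial>friend_process)"
  proof (rule nn_integral_cong)
    fix \<omega>
    have "measure (friend_step n \<omega>) (- set_pmf (friend_step n \<omega>)) = 0"
      unfolding measure_pmf_zero_iff by auto
    then show "(\<integral>\<^sup>+p. indicator (- set_pmf (friend_step n \<omega>)) p \<partial>friend_step n \<omega>) = (0::ennreal)"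
      by (simp add: measure_pmf.emeasure_eq_measure)
  qed
  also have "\<dots> = 0" by simp
  finally have *: "(\<integral>\<^sup>+\<omega>. indicator (- set_pmf (friend_step n \<omega>)) (\<omega> n) \<partial>friend_process) = (0::ennreal)" .
  have "(\<lambda>\<omega>. indicator (- set_pmf (friend_step n \<omega>)) (\<omega> n) :: ennreal) \<in> borel_measurable friend_process"
  proof (rule borel_measurable_history_function)
    fix \<omega> \<omega>' :: "nat \<Rightarrow> nat \<times> nat" assume "\<And>i. i < Suc n \<Longrightarrow> \<omega> i = \<omega>' i"
    then show "(indicator (- set_pmf (friend_step n \<omega>)) (\<omega> n) :: ennreal) =
        indicator (- set_pmf (friend_step n \<omega>')) (\<omega>' n)"
      using friend_step_cong[of n \<omega> \<omega>'] by simp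
  qed
  from nn_integral_0_iff_AE[OF this] * show "AE \<omega> in friend_process. \<omega> n \<in> set_pmf (friend_step n \<omega>)"
    by (auto simp: indicator_def)
qed

lemma three_vertex_tree:
  assumes w: "w \<in> {1, 2}"
  defines "G \<equiv> insert {3, w} {{1, 2::nat}}"
  shows "friend_graph 3 G" "hub_sum growth_weight G = 4"
proof -
  define u where "u = 3 - w"
  have wu: "w \<noteq> u" "w \<noteq> 3" "u \<noteq> 3" "{1, 2} = {w, u}" using w by (auto simp: u_def)
  have G: "G = {{3, w}, {w, u}}" by (simp only: G_def wu(4))
  have N: "neighbours G v = (if v = w then {u, 3} else if v = u \<or> v = 3 then {w} else {})" for v
    using wu(1-3) by (auto simp: G neighbours_def doubleton_eq_iff)
  have d: "vertex_degree G v = (if v = w then 2 else if v = u \<or> v = 3 then 1 else 0)" for v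
    using wu(1-3) by (simp add: vertex_degree_def N)
  have h: "hubs G = {w}" by (auto simp: hubs_def d)
  have "leaf_nbrs G w = {u, 3}" using wu(1-3) by (auto simp: leaf_nbrs_def N d)
  then have l: "leaf_count G w = 2" using wu(1-3) by (simp add: leaf_count_def)
  show "hub_sum growth_weight G = 4"
    by (simp add: hub_sum_def h l growth_weight_def)
  have v: "v \<in> {1..3} \<longleftrightarrow> v = w \<or> v = u \<or> v = 3" for v
    using w by (auto simp: u_def)
  show "friend_graph 3 G"
  proof
    show "neighbours G x \<subseteq> {1..3} - {x}" for x
      using wu(1-3) v by (auto simp only: N subset_iff split: if_splits) 
    show "neighbours G x \<noteq> {}" if "x \<in> {1..3}" for x
      using that unfolding v by (auto simp: N)
    show "b \<in> hubs G" if "vertex_degree G a = 1" "b \<in> neighbours G a" for a b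
      using that by (auto simp: h N d split: if_splits)
  qed (simp_all add: h l d)
qed

lemma nn_integral_friend_step_mean:
  assumes "friend_graph n (friend_tree \<omega> n)" and nonneg: "\<And>w. 0 \<le> h w"
  shows "(\<integral>\<^sup>+p. ennreal (h (snd p)) \<partial>friend_step n \<omega>) =
    ennreal ((\<Sum>w\<in>{1..n}. attach_weight (friend_tree \<omega> n) w * h w) / real n)"
proof -
  let ?G = "friend_tree \<omega> n"
  interpret friend_graph n ?G by fact
  have inner: "(\<integral>\<^sup>+w. ennreal (h w) \<partial>pmf_of_set (neighbours ?G v)) =
      ennreal ((\<Sum>w\<in>neighbours ?G v. h w) / real (vertex_degree ?G v))" if "v \<in> {1..n}" for v
    using nbrs_nonempty[OF that] finite_nbrs[of v] nonneg
    by (simp add: nn_integral_pmf_of_set vertex_degree_def sum_nonneg divide_ennreal card_gt_0_iff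
        ennreal_of_nat_eq_real_of_nat)
  have "(\<integral>\<^sup>+p. ennreal (h (snd p)) \<partial>friend_step n \<omega>) =
      (\<integral>\<^sup>+v. \<integral>\<^sup>+w. ennreal (h w) \<partial>pmf_of_set (neighbours ?G v) \<partial>pmf_of_set {1..n})"
    using size by (simp add: friend_step_def)
  also have "\<dots> = (\<Sum>v\<in>{1..n}. \<integral>\<^sup>+w. ennreal (h w) \<partial>pmf_of_set (neighbours ?G v)) / of_nat n"
    using size by (subst nn_integral_pmf_of_set) auto
  also have "(\<Sum>v\<in>{1..n}. \<integral>\<^sup>+w. ennreal (h w) \<partial>pmf_of_set (neighbours ?G v)) =
      (\<Sum>v\<in>{1..n}. ennreal ((\<Sum>w\<in>neighbours ?G v. h w) / real (vertex_degree ?G v)))"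
    by (rule sum.cong[OF refl], rule inner)
  also have "\<dots> = ennreal (\<Sum>v\<in>{1..n}. (\<Sum>w\<in>neighbours ?G v. h w) / real (vertex_degree ?G v))"
    using nonneg by (intro sum_ennreal divide_nonneg_nonneg sum_nonneg) auto
  also have "\<dots> / of_nat n = ennreal ((\<Sum>v\<in>{1..n}. (\<Sum>w\<in>neighbours ?G v. h w) / real (vertex_degree ?G v)) / real n)"
    unfolding ennreal_of_nat_eq_real_of_nat
    using size nonneg by (intro divide_ennreal sum_nonneg divide_nonneg_nonneg) auto
  finally show ?thesis by (simp only: sum_attach_weight_vertices)
qed

text \<open>The histories on which every new vertex is attached to an existing one.  The step from two to three
  vertices is separate because in a single edge both vertices are leaves.\<close>

definition tree_history :: "(nat \<Rightarrow> nat \<times> nat) \<Rightarrow> bool" where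
  "tree_history \<omega> \<longleftrightarrow> snd (\<omega> 2) \<in> {1, 2} \<and> (\<forall>n\<ge>3. snd (\<omega> n) \<in> {1..n})"

lemma friend_tree_3: "friend_tree \<omega> 3 = insert {3, snd (\<omega> 2)} {{1, 2}}"
  by (simp add: numeral_3_eq_3 numeral_2_eq_2)

lemma friend_tree_Suc: "3 \<le> n \<Longrightarrow> friend_tree \<omega> (Suc n) = insert {Suc n, snd (\<omega> n)} (friend_tree \<omega> n)"
  by simp

lemma tree_history_friend_graph:
  assumes "tree_history \<omega>" "3 \<le> n"
  shows "friend_graph n (friend_tree \<omega> n)"
  using assms(2)
proof (induction n rule: dec_induct)
  case base
  show ?case
    using three_vertex_tree(1)[of "snd (\<omega> 2)"] assms(1) by (simp add: friend_tree_3 tree_history_def)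
next
  case (step n)
  then show ?case
    using friend_graph.friend_graph_attach[OF step.IH] assms(1)
    by (simp only: friend_tree_Suc) (simp add: tree_history_def)
qed

lemma tree_history_hubs_mono:
  assumes "tree_history \<omega>" "3 \<le> m" "m \<le> n"
  shows "hubs (friend_tree \<omega> m) \<subseteq> hubs (friend_tree \<omega> n)"
  using assms(3)
proof (induction n rule: dec_induct)
  case (step n)
  then have n: "3 \<le> n" using assms(2) by simp
  with assms(1) have w: "snd (\<omega> n) \<in> {1..n}" by (simp add: tree_history_def)
  show ?case
    using step.IH friend_graph.hubs_attach[OF tree_history_friend_graph[OF assms(1) n] w]
    by (simp only: friend_tree_Suc[OF n]) auto
qed simp

lemma tree_history_growth_mono:
  assumes "tree_history \<omega>" "3 \<le> m" "m \<le> n"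
  shows "hub_sum growth_weight (friend_tree \<omega> m) \<le> hub_sum growth_weight (friend_tree \<omega> n)"
  using assms(3)
proof (induction n rule: dec_induct)
  case (step n)
  then have n: "3 \<le> n" using assms(2) by simp
  with assms(1) have w: "snd (\<omega> n) \<in> {1..n}" by (simp add: tree_history_def)
  show ?case
    using step.IH friend_graph.hub_sum_growth_attach[OF tree_history_friend_graph[OF assms(1) n] w]
    by (simp only: friend_tree_Suc[OF n])
qed simp

lemma tree_history_growth_ge_4:
  assumes "tree_history \<omega>" "3 \<le> n"
  shows "4 \<le> hub_sum growth_weight (friend_tree \<omega> n)"
proof -
  have "hub_sum growth_weight (friend_tree \<omega> 3) = 4"
    using three_vertex_tree(2)[of "snd (\<omega> 2)"] assms(1) by (simp add: friend_tree_3 tree_history_def)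
  then show ?thesis
    using tree_history_growth_mono[OF assms(1) order_refl assms(2)] by simp
qed

lemma AE_tree_history: "AE \<omega> in friend_process. tree_history \<omega>"
  using AE_friend_step_support
proof eventually_elim
  fix \<omega> :: "nat \<Rightarrow> nat \<times> nat"
  assume supp: "\<forall>n. \<omega> n \<in> set_pmf (friend_step n \<omega>)"
  have T2: "friend_tree \<omega> 2 = {{1, 2}}" by (simp add: numeral_2_eq_2)
  have N: "neighbours {{1, 2}} 1 = {2}" "neighbours {{1, 2 :: nat}} 2 = {1}"
    by (auto simp: neighbours_def doubleton_eq_iff)
  have "\<omega> 2 \<in> set_pmf (friend_step 2 \<omega>)" using supp by blast
  then obtain v where v: "v \<in> set_pmf (pmf_of_set {1..2::nat})"
    and w: "snd (\<omega> 2) \<in> set_pmf (pmf_of_set (neighbours {{1, 2}} v))"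
    unfolding friend_step_def T2 set_bind_pmf if_not_P[OF less_irrefl] set_return_pmf UN_iff by force
  have "set_pmf (pmf_of_set {1..2::nat}) = {1..2}"
    by (rule set_pmf_of_set) auto
  with v have "v = 1 \<or> v = 2" by auto
  then have two: "snd (\<omega> 2) \<in> {1, 2}"
  proof
    assume "v = 1"
    with w have "snd (\<omega> 2) \<in> {2}" by (simp only: N) (simp add: set_pmf_of_set)
    then show ?thesis by simp
  next
    assume "v = 2"
    with w have "snd (\<omega> 2) \<in> {1}" by (simp only: N) (simp add: set_pmf_of_set)
    then show ?thesis by simp
  qed
  have vertex: "snd (\<omega> n) \<in> {1..n}" if "friend_graph n (friend_tree \<omega> n)" for n
  proof -
    interpret friend_graph n "friend_tree \<omega> n" by fact
    have V: "set_pmf (pmf_of_set {1..n}) = {1..n}"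
      using size by (intro set_pmf_of_set) auto
    have "\<omega> n \<in> set_pmf (friend_step n \<omega>)" using supp by blast
    then obtain v where v: "v \<in> {1..n}" and w: "snd (\<omega> n) \<in> set_pmf (pmf_of_set (neighbours (friend_tree \<omega> n) v))"
      using size unfolding friend_step_def by (auto simp only: V set_bind_pmf set_return_pmf UN_iff singleton_iff snd_conv split: if_splits)
    have "snd (\<omega> n) \<in> neighbours (friend_tree \<omega> n) v"
      using w nbrs_nonempty[OF v] finite_nbrs[of v] by simp
    from subsetD[OF nbrs this] show ?thesis by (rule DiffD1)
  qed
  have "friend_graph n (friend_tree \<omega> n)" if "3 \<le> n" for n
    using that
  proof (induction n rule: dec_induct)
    case base
    show ?case
      using three_vertex_tree(1)[OF two] by (simp only: friend_tree_3)
  next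
    case (step n)
    from friend_graph.friend_graph_attach[OF step.IH vertex[OF step.IH]] show ?case
      by (simp only: friend_tree_Suc[OF step.hyps(1)])
  qed
  then have "\<forall>n\<ge>3. snd (\<omega> n) \<in> {1..n}" using vertex by blast
  with two show "tree_history \<omega>" unfolding tree_history_def by blast
qed

text \<open>This turns the drift estimates into recursions for expectations.  The factor \<open>c\<close> lets the estimate be restricted
  to an event that is decided before time \<open>n\<close>.\<close>

lemma nn_integral_friend_tree_step_le:
  fixes c g :: "_ \<Rightarrow> real" and f :: "_ \<Rightarrow> real"
  assumes n: "3 \<le> n" and c: "\<And>\<omega>. 0 \<le> c \<omega>" and f: "\<And>H. 0 \<le> f H"
    and history: "\<And>\<omega> \<omega>'. (\<And>i. i < n \<Longrightarrow> \<omega> i = \<omega>' i) \<Longrightarrow> c \<omega> = c \<omega>'"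
    and bound: "\<And>\<omega>. tree_history \<omega> \<Longrightarrow> friend_graph n (friend_tree \<omega> n) \<Longrightarrow>
      c \<omega> * step_mean n (friend_tree \<omega> n) f \<le> g \<omega>"
  shows "(\<integral>\<^sup>+\<omega>. ennreal (c \<omega> * f (friend_tree \<omega> (Suc n))) \<partial>friend_process) \<le>
    (\<integral>\<^sup>+\<omega>. ennreal (g \<omega>) \<partial>friend_process)"
proof -
  let ?h = "\<lambda>\<omega> w. c \<omega> * f (insert {Suc n, w} (friend_tree \<omega> n))"
  have "(\<integral>\<^sup>+\<omega>. ennreal (c \<omega> * f (friend_tree \<omega> (Suc n))) \<partial>friend_process) =
      (\<integral>\<^sup>+\<omega>. ennreal (?h \<omega> (snd (\<omega> n))) \<partial>friend_process)"
    using n by simp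
  also have "\<dots> = (\<integral>\<^sup>+\<omega>. (\<integral>\<^sup>+p. ennreal (?h \<omega> (snd p)) \<partial>friend_step n \<omega>) \<partial>friend_process)"
  proof (rule nn_integral_friend_step)
    fix \<omega> \<omega>' :: "nat \<Rightarrow> nat \<times> nat" and p :: "nat \<times> nat" assume "\<And>i. i < n \<Longrightarrow> \<omega> i = \<omega>' i"
    then show "ennreal (?h \<omega> (snd p)) = ennreal (?h \<omega>' (snd p))"
      using history[of \<omega> \<omega>'] friend_tree_cong[of n \<omega> \<omega>'] by simp
  qed
  also have "\<dots> \<le> (\<integral>\<^sup>+\<omega>. ennreal (g \<omega>) \<partial>friend_process)"
  proof (rule nn_integral_mono_AE, use AE_tree_history in eventually_elim)
    fix \<omega> assume \<omega>: "tree_history \<omega>"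
    note G = tree_history_friend_graph[OF \<omega> n]
    have "(\<integral>\<^sup>+p. ennreal (?h \<omega> (snd p)) \<partial>friend_step n \<omega>) =
        ennreal (c \<omega> * step_mean n (friend_tree \<omega> n) f)"
      using nn_integral_friend_step_mean[OF G, of "?h \<omega>"] c f
      by (simp add: step_mean_def sum_distrib_left mult_ac)
    also have "\<dots> \<le> ennreal (g \<omega>)"
      by (intro ennreal_leI bound \<omega> G)
    finally show "(\<integral>\<^sup>+p. ennreal (?h \<omega> (snd p)) \<partial>friend_step n \<omega>) \<le> ennreal (g \<omega>)" .
  qed
  finally show ?thesis .
qed

lemma borel_measurable_friend_tree:
  fixes f :: "nat set set \<Rightarrow> real"
  shows "(\<lambda>\<omega>. f (friend_tree \<omega> n)) \<in> borel_measurable friend_process"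
proof (rule borel_measurable_history_function)
  fix \<omega> \<omega>' :: "nat \<Rightarrow> nat \<times> nat" assume "\<And>i. i < n \<Longrightarrow> \<omega> i = \<omega>' i"
  then show "f (friend_tree \<omega> n) = f (friend_tree \<omega>' n)" using friend_tree_cong[of n \<omega> \<omega>'] by simp
qed

section \<open>Powers, powers of two and summable expectations\<close>

text \<open>One step of the recursion $e_{n+1} \<le> (1 + a/n) e_n$, compared with a multiple of $(n-1)^a$; the
  shift by one saves a further constant.\<close>

lemma powr_step_up:
  fixes n a :: real
  assumes "2 \<le> n" "0 \<le> a"
  shows "(1 + a / n) * (n - 1) powr a \<le> n powr a"
proof -
  have "ln (1 - 1 / n) \<le> - (1 / n)"
    using ln_le_minus_one[of "1 - 1 / n"] assms by simp
  moreover have "1 - 1 / n = (n - 1) / n" using assms by (simp add: field_simps)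
  ultimately have "1 / n \<le> ln n - ln (n - 1)"
    using assms by (simp add: ln_div)
  from mult_left_mono[OF this assms(2)] have "a / n \<le> a * ln n - a * ln (n - 1)"
    by (simp add: algebra_simps)
  then have "exp (a / n) \<le> exp (a * ln n) / exp (a * ln (n - 1))"
    by (simp flip: exp_diff)
  then have "exp (a / n) \<le> n powr a / (n - 1) powr a"
    using assms by (simp add: powr_def)
  moreover have "1 + a / n \<le> exp (a / n)" by (rule exp_ge_add_one_self)
  ultimately have "1 + a / n \<le> n powr a / (n - 1) powr a" by linarith
  then show ?thesis using assms by (simp add: field_simps)
qed

lemma powr_step_down:
  fixes n a :: real
  assumes "1 \<le> n" "0 \<le> a"
  shows "(1 - a / n) * n powr - a \<le> (n + 1) powr - a"
proof -
  have "ln (1 + 1 / n) \<le> 1 / n"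
    using assms by (intro ln_add_one_self_le_self) auto
  moreover have "1 + 1 / n = (n + 1) / n" using assms by (simp add: field_simps)
  ultimately have "ln (n + 1) - ln n \<le> 1 / n"
    using assms by (simp add: ln_div)
  from mult_left_mono[OF this assms(2)] have "- (a / n) \<le> - (a * ln (n + 1)) - - (a * ln n)"
    by (simp add: algebra_simps)
  then have "exp (- (a / n)) \<le> exp (- (a * ln (n + 1))) / exp (- (a * ln n))"
    by (simp flip: exp_diff)
  then have "exp (- (a / n)) \<le> (n + 1) powr - a / n powr - a"
    using assms by (simp add: powr_def)
  moreover have "1 - a / n \<le> exp (- (a / n))" using exp_ge_add_one_self[of "- (a / n)"] by simp
  ultimately have "1 - a / n \<le> (n + 1) powr - a / n powr - a" by linarith
  then show ?thesis using assms by (simp add: field_simps)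
qed

lemma dyadic_bracket:
  assumes "1 \<le> (n::nat)"
  obtains i where "2 ^ i \<le> n" "n < 2 ^ Suc i"
  using ex_power_ivl1[of 2 n] assms by auto

text \<open>A monotone sequence is controlled by its values at the powers of two, at the cost of a constant
  factor.\<close>

lemma eventually_le_powr_if_dyadic:
  fixes x :: "nat \<Rightarrow> real"
  assumes mono: "\<And>m n. 3 \<le> m \<Longrightarrow> m \<le> n \<Longrightarrow> x m \<le> x n" and a: "0 \<le> a"
    and ev: "\<forall>\<^sub>F i in sequentially. x (2 ^ i) \<le> (2 ^ i) powr a"
  shows "\<forall>\<^sub>F n in sequentially. x n \<le> 2 powr a * real n powr a"
proof -
  obtain I where I: "\<And>i. I \<le> i \<Longrightarrow> x (2 ^ i) \<le> (2 ^ i) powr a"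
    using ev by (auto simp: eventually_sequentially)
  show ?thesis
    using eventually_ge_at_top[of "max 3 (2 ^ I)"]
  proof eventually_elim
    case (elim n)
    then have "1 \<le> n" by simp
    then obtain i where i: "2 ^ i \<le> n" "n < 2 ^ Suc i" by (rule dyadic_bracket)
    have "2 ^ I < (2 ^ Suc i :: nat)" using elim i(2) by linarith
    then have "I \<le> Suc i" by (subst (asm) power_strict_increasing_iff) auto
    have "x n \<le> x (2 ^ Suc i)" using elim i by (intro mono) auto
    also have "\<dots> \<le> (2 ^ Suc i) powr a" using I \<open>I \<le> Suc i\<close> by blast
    also have "\<dots> \<le> (2 * real n) powr a"
      using i(1) a by (intro powr_mono2) (auto simp flip: of_nat_le_iff)
    finally show ?case by (simp add: powr_mult)
  qed
qed

lemma eventually_ge_powr_if_dyadic: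
  fixes x :: "nat \<Rightarrow> real"
  assumes mono: "\<And>m n. 3 \<le> m \<Longrightarrow> m \<le> n \<Longrightarrow> x m \<le> x n" and a: "0 \<le> a"
    and ev: "\<forall>\<^sub>F i in sequentially. (2 ^ i) powr a \<le> x (2 ^ i)"
  shows "\<forall>\<^sub>F n in sequentially. (real n / 2) powr a \<le> x n"
proof -
  obtain I where I: "\<And>i. I \<le> i \<Longrightarrow> (2 ^ i) powr a \<le> x (2 ^ i)"
    using ev by (auto simp: eventually_sequentially)
  show ?thesis
    using eventually_ge_at_top[of "max 8 (2 ^ Suc I)"]
  proof eventually_elim
    case (elim n)
    then have "1 \<le> n" by simp
    then obtain i where i: "2 ^ i \<le> n" "n < 2 ^ Suc i" by (rule dyadic_bracket)
    have "2 ^ Suc I < (2 ^ Suc i :: nat)"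
      by (rule le_less_trans[OF _ i(2)]) (use elim in simp)
    moreover have "2 ^ 2 < (2 ^ Suc i :: nat)"
      by (rule le_less_trans[OF _ i(2)]) (use elim in simp)
    ultimately have "I \<le> i" "2 \<le> i" by (auto simp only: power_strict_increasing_iff)
    have "2 ^ 2 \<le> (2 ^ i :: nat)" using \<open>2 \<le> i\<close> by (rule power_increasing) simp
    then have "3 \<le> (2 ^ i :: nat)" by simp
    have "real n < real (2 ^ Suc i)" using i(2) by (simp only: of_nat_less_iff)
    then have "(real n / 2) powr a \<le> (2 ^ i) powr a"
      using a by (intro powr_mono2) auto
    also have "\<dots> \<le> x (2 ^ i)" using I \<open>I \<le> i\<close> by blast
    also have "\<dots> \<le> x n" using mono i(1) \<open>3 \<le> 2 ^ i\<close> by blast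
    finally show ?case .
  qed
qed

text \<open>Markov's inequality and the Borel--Cantelli lemma in one: the sum of the functions has a finite
  integral, so that it is finite almost everywhere.\<close>

lemma AE_tendsto_zero_if_summable:
  fixes f :: "nat \<Rightarrow> 'a \<Rightarrow> real"
  assumes meas: "\<And>i. f i \<in> borel_measurable M" and nonneg: "\<And>i x. 0 \<le> f i x"
    and bound: "\<And>i. (\<integral>\<^sup>+x. ennreal (f i x) \<partial>M) \<le> ennreal (b i)"
    and b: "\<And>i. 0 \<le> b i" "summable b"
  shows "AE x in M. (\<lambda>i. f i x) \<longlonglongrightarrow> 0"
proof -
  have "(\<integral>\<^sup>+x. (\<Sum>i. ennreal (f i x)) \<partial>M) = (\<Sum>i. \<integral>\<^sup>+x. ennreal (f i x) \<partial>M)"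
    using meas by (intro nn_integral_suminf) simp
  also have "\<dots> \<le> (\<Sum>i. ennreal (b i))"
    by (intro suminf_le bound) auto
  also have "\<dots> < \<infinity>"
    using b by (simp add: suminf_ennreal2 ennreal_suminf_neq_top less_top)
  finally have "(\<integral>\<^sup>+x. (\<Sum>i. ennreal (f i x)) \<partial>M) \<noteq> \<infinity>" by simp
  then have "AE x in M. (\<Sum>i. ennreal (f i x)) \<noteq> \<infinity>"
    using meas by (intro nn_integral_PInf_AE) simp_all
  then show ?thesis
  proof eventually_elim
    case (elim x)
    then have "summable (\<lambda>i. f i x)"
      using nonneg by (intro summable_suminf_not_top) auto
    then show ?case by (rule summable_LIMSEQ_zero)
  qed
qed

text \<open>Along the powers of two, any gain in the exponent is a geometric factor and hence summable.\<close>

lemma AE_eventually_le_dyadic: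
  fixes f :: "nat set set \<Rightarrow> real"
  assumes f: "\<And>H. 0 \<le> f H" and C: "0 \<le> C" and s: "s < t"
    and bound: "\<And>n. 3 \<le> n \<Longrightarrow> (\<integral>\<^sup>+\<omega>. ennreal (f (friend_tree \<omega> n)) \<partial>friend_process) \<le> ennreal (C * real n powr s)"
  shows "AE \<omega> in friend_process. \<forall>\<^sub>F i in sequentially. f (friend_tree \<omega> (2 ^ i)) \<le> (2 ^ i) powr t"
proof -
  let ?f = "\<lambda>i \<omega>. f (friend_tree \<omega> (2 ^ (i + 2))) / (2 ^ (i + 2)) powr t"
  let ?b = "\<lambda>i. C * (2 powr (s - t)) ^ (i + 2)"
  have "AE \<omega> in friend_process. (\<lambda>i. ?f i \<omega>) \<longlonglongrightarrow> 0"
  proof (rule AE_tendsto_zero_if_summable)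
    show "?f i \<in> borel_measurable friend_process" for i
      by (intro borel_measurable_divide borel_measurable_friend_tree borel_measurable_const)
    show "0 \<le> ?f i \<omega>" for i \<omega> using f by simp
    show "0 \<le> ?b i" for i using C by simp
    have "summable (\<lambda>i. (2 powr (s - t)) ^ i)"
      using s powr_less_mono[of "s - t" 0 2] by (intro summable_geometric) auto
    then show "summable ?b" by (intro summable_mult) (rule summable_ignore_initial_segment)
    show "(\<integral>\<^sup>+\<omega>. ennreal (?f i \<omega>) \<partial>friend_process) \<le> ennreal (?b i)" for i
    proof -
      let ?n = "2 ^ (i + 2) :: nat"
      have "2 ^ 2 \<le> ?n" by (rule power_increasing) simp_all
      from order_trans[OF _ this, of 3] have n: "3 \<le> ?n" by simp
      have "(\<integral>\<^sup>+\<omega>. ennreal (?f i \<omega>) \<partial>friend_process) =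
          (\<integral>\<^sup>+\<omega>. ennreal (1 / real ?n powr t) * ennreal (f (friend_tree \<omega> ?n)) \<partial>friend_process)"
        using f by (intro nn_integral_cong) (simp add: ennreal_mult'[symmetric])
      also have "\<dots> = ennreal (1 / real ?n powr t) * (\<integral>\<^sup>+\<omega>. ennreal (f (friend_tree \<omega> ?n)) \<partial>friend_process)"
        by (intro nn_integral_cmult measurable_compose[OF borel_measurable_friend_tree] measurable_ennreal)
      also have "\<dots> \<le> ennreal (1 / real ?n powr t) * ennreal (C * real ?n powr s)"
        by (intro mult_left_mono bound n) auto
      also have "\<dots> = ennreal (C * real ?n powr (s - t))"
        using C by (subst ennreal_mult[symmetric]) (auto simp: powr_diff)
      also have "real ?n powr (s - t) = (2 powr (s - t)) ^ (i + 2)"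
        by (simp add: powr_power powr_realpow[symmetric] powr_powr mult_ac del: power_add power_Suc add_2_eq_Suc')
      finally show ?thesis .
    qed
  qed
  then show ?thesis
  proof eventually_elim
    case (elim \<omega>)
    from order_tendstoD(2)[OF this, of 1] have "\<forall>\<^sub>F i in sequentially. ?f i \<omega> < 1" by simp
    then have "\<forall>\<^sub>F i in sequentially. f (friend_tree \<omega> (2 ^ (i + 2))) \<le> (2 ^ (i + 2)) powr t"
      by eventually_elim (simp add: field_simps)
    then show ?case
      by (subst (asm) eventually_sequentially_seg[of "\<lambda>i. f (friend_tree \<omega> (2 ^ i)) \<le> (2 ^ i) powr t"])
  qed
qed

section \<open>An upper bound for the number of hubs\<close>

lemma nn_integral_ceiling:
  assumes "3 \<le> n"
  shows "(\<integral>\<^sup>+\<omega>. ennreal (hub_sum ceiling_weight (friend_tree \<omega> n)) \<partial>friend_process) \<le>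
    ennreal (18 * (real n - 1) powr (5 / 6))"
  using assms
proof (induction n rule: dec_induct)
  case base
  have "(\<integral>\<^sup>+\<omega>. ennreal (hub_sum ceiling_weight (friend_tree \<omega> 3)) \<partial>friend_process) \<le>
      (\<integral>\<^sup>+\<omega>. ennreal 18 \<partial>friend_process)"
  proof (rule nn_integral_mono_AE, use AE_tree_history in eventually_elim)
    fix \<omega> assume "tree_history \<omega>"
    then interpret friend_graph 3 "friend_tree \<omega> 3" by (rule tree_history_friend_graph) simp
    have "hub_sum ceiling_weight (friend_tree \<omega> 3) \<le> (\<Sum>v\<in>hubs (friend_tree \<omega> 3). 6)"
      unfolding hub_sum_def by (rule sum_mono) (simp add: ceiling_weight_def)
    also have "\<dots> \<le> 6 * real (card {1..3::nat})"
      using card_mono[OF _ hubs_subset] by simp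
    finally show "ennreal (hub_sum ceiling_weight (friend_tree \<omega> 3)) \<le> ennreal 18"
      by (intro ennreal_leI) simp
  qed
  also have "\<dots> = ennreal 18"
    using prob_space.emeasure_space_1[OF prob_space_friend_process] by simp
  also have "\<dots> \<le> ennreal (18 * (real 3 - 1) powr (5 / 6))"
    by (intro ennreal_leI) (simp add: ge_one_powr_ge_zero)
  finally show ?case .
next
  case (step n)
  let ?S = "\<lambda>\<omega>. hub_sum ceiling_weight (friend_tree \<omega> n)"
  have "(\<integral>\<^sup>+\<omega>. ennreal (1 * hub_sum ceiling_weight (friend_tree \<omega> (Suc n))) \<partial>friend_process) \<le>
      (\<integral>\<^sup>+\<omega>. ennreal ((1 + 5 / 6 / real n) * ?S \<omega>) \<partial>friend_process)"
    using friend_graph.step_mean_ceiling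
    by (intro nn_integral_friend_tree_step_le step.hyps) (auto intro: hub_sum_nonneg ceiling_weight_nonneg)
  also have "\<dots> = ennreal (1 + 5 / 6 / real n) * (\<integral>\<^sup>+\<omega>. ennreal (?S \<omega>) \<partial>friend_process)"
    by (subst nn_integral_cmult[symmetric])
      (auto simp: ennreal_mult' borel_measurable_friend_tree intro!: measurable_compose[OF borel_measurable_friend_tree])
  also have "\<dots> \<le> ennreal (1 + 5 / 6 / real n) * ennreal (18 * (real n - 1) powr (5 / 6))"
    by (intro mult_left_mono step.IH) auto
  also have "\<dots> = ennreal (18 * ((1 + 5 / 6 / real n) * (real n - 1) powr (5 / 6)))"
    by (subst ennreal_mult[symmetric]) (auto simp: mult_ac)
  also have "\<dots> \<le> ennreal (18 * (real (Suc n) - 1) powr (5 / 6))"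
    using powr_step_up[of "real n" "5 / 6"] step.hyps by (intro ennreal_leI) auto
  finally show ?case by simp
qed

lemma AE_eventually_card_hubs_le:
  "AE \<omega> in friend_process. \<forall>\<^sub>F n in sequentially.
    real (card (hubs (friend_tree \<omega> n))) \<le> 2 powr (6 / 7) * real n powr (6 / 7)"
proof -
  have "AE \<omega> in friend_process. \<forall>\<^sub>F i in sequentially.
      hub_sum ceiling_weight (friend_tree \<omega> (2 ^ i)) \<le> (2 ^ i) powr (6 / 7)"
  proof (rule AE_eventually_le_dyadic[where C = 18 and s = "5 / 6"])
    fix n :: nat assume n: "3 \<le> n"
    have "ennreal (18 * (real n - 1) powr (5 / 6)) \<le> ennreal (18 * real n powr (5 / 6))"
      using n by (intro ennreal_leI mult_left_mono powr_mono2) auto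
    with nn_integral_ceiling[OF n]
    show "(\<integral>\<^sup>+\<omega>. ennreal (hub_sum ceiling_weight (friend_tree \<omega> n)) \<partial>friend_process) \<le> ennreal (18 * real n powr (5 / 6))"
      by (rule order_trans)
  qed (auto intro: hub_sum_nonneg ceiling_weight_nonneg)
  then show ?thesis
    using AE_tree_history
  proof eventually_elim
    case (elim \<omega>)
    show ?case
    proof (rule eventually_le_powr_if_dyadic)
      fix m n :: nat assume mn: "3 \<le> m" "m \<le> n"
      from elim(2) mn have "friend_graph n (friend_tree \<omega> n)" by (intro tree_history_friend_graph) auto
      then have "finite (hubs (friend_tree \<omega> n))" by (rule friend_graph.finite_hubs)
      with tree_history_hubs_mono[OF elim(2) mn]
      show "real (card (hubs (friend_tree \<omega> m))) \<le> real (card (hubs (friend_tree \<omega> n)))"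
        by (simp add: card_mono)
    next
      show "\<forall>\<^sub>F i in sequentially. real (card (hubs (friend_tree \<omega> (2 ^ i)))) \<le> (2 ^ i) powr (6 / 7)"
        using elim(1) eventually_ge_at_top[of 2]
      proof eventually_elim
        fix i :: nat assume le: "hub_sum ceiling_weight (friend_tree \<omega> (2 ^ i)) \<le> (2 ^ i) powr (6 / 7)" and i: "2 \<le> i"
        have "2 ^ 2 \<le> (2 ^ i :: nat)" using i by (rule power_increasing) simp
        then have "friend_graph (2 ^ i) (friend_tree \<omega> (2 ^ i))"
          by (intro tree_history_friend_graph[OF elim(2)]) simp
        from friend_graph.card_hubs_le_ceiling[OF this] le
        show "real (card (hubs (friend_tree \<omega> (2 ^ i)))) \<le> (2 ^ i) powr (6 / 7)" by simp
      qed
    qed simp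
  qed
qed

section \<open>A lower bound for the number of hubs with a leaf\<close>

lemma nn_integral_inverse_growth:
  assumes "3 \<le> n"
  shows "(\<integral>\<^sup>+\<omega>. ennreal (1 / hub_sum growth_weight (friend_tree \<omega> n)) \<partial>friend_process) \<le>
    ennreal (3 * real n powr (- (1 / 7)))"
  using assms
proof (induction n rule: dec_induct)
  case base
  have "(\<integral>\<^sup>+\<omega>. ennreal (1 / hub_sum growth_weight (friend_tree \<omega> 3)) \<partial>friend_process) \<le>
      (\<integral>\<^sup>+\<omega>. ennreal 1 \<partial>friend_process)"
  proof (rule nn_integral_mono_AE, use AE_tree_history in eventually_elim)
    fix \<omega> assume "tree_history \<omega>"
    from tree_history_growth_ge_4[OF this order_refl]
    show "ennreal (1 / hub_sum growth_weight (friend_tree \<omega> 3)) \<le> ennreal 1"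
      by (intro ennreal_leI) simp
  qed
  also have "\<dots> = ennreal 1"
    using prob_space.emeasure_space_1[OF prob_space_friend_process] by simp
  also have "\<dots> \<le> ennreal (3 * real 3 powr (- (1 / 7)))"
  proof (rule ennreal_leI)
    have "(3::real) powr -1 \<le> 3 powr (- (1 / 7))" by (intro powr_mono) auto
    then show "1 \<le> 3 * real 3 powr (- (1 / 7))" by (simp add: powr_minus_divide)
  qed
  finally show ?case .
next
  case (step n)
  let ?S = "\<lambda>\<omega>. hub_sum growth_weight (friend_tree \<omega> n)"
  have "(\<integral>\<^sup>+\<omega>. ennreal (1 * (1 / hub_sum growth_weight (friend_tree \<omega> (Suc n)))) \<partial>friend_process) \<le>
      (\<integral>\<^sup>+\<omega>. ennreal ((1 - 1 / (7 * real n)) * (1 / ?S \<omega>)) \<partial>friend_process)"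
  proof (rule nn_integral_friend_tree_step_le[where f = "\<lambda>H. 1 / hub_sum growth_weight H"])
    fix \<omega> assume \<omega>: "tree_history \<omega>" and G: "friend_graph n (friend_tree \<omega> n)"
    show "1 * step_mean n (friend_tree \<omega> n) (\<lambda>H. 1 / hub_sum growth_weight H) \<le>
        (1 - 1 / (7 * real n)) * (1 / ?S \<omega>)"
      using friend_graph.step_mean_growth[OF G tree_history_growth_ge_4[OF \<omega> step.hyps(1)]] by simp
  qed (use step.hyps in \<open>auto intro: hub_sum_nonneg growth_weight_nonneg\<close>)
  also have "\<dots> = ennreal (1 - 1 / (7 * real n)) * (\<integral>\<^sup>+\<omega>. ennreal (1 / ?S \<omega>) \<partial>friend_process)"
    using step.hyps
    by (subst nn_integral_cmult[symmetric])
      (auto simp: ennreal_mult'[symmetric] intro!: measurable_compose[OF borel_measurable_friend_tree[of "\<lambda>H. 1 / hub_sum growth_weight H"]])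
  also have "\<dots> \<le> ennreal (1 - 1 / (7 * real n)) * ennreal (3 * real n powr (- (1 / 7)))"
    by (intro mult_left_mono step.IH) auto
  also have "\<dots> = ennreal (3 * ((1 - 1 / 7 / real n) * real n powr (- (1 / 7))))"
    using step.hyps by (subst ennreal_mult[symmetric]) (auto simp: mult_ac)
  also have "\<dots> \<le> ennreal (3 * (real (Suc n)) powr (- (1 / 7)))"
    using powr_step_down[of "real n" "1 / 7"] step.hyps by (intro ennreal_leI) (auto simp: add_ac)
  finally show ?case by simp
qed

text \<open>The bound on the mean reciprocal excludes that the weight stays small along the powers
  of two, and monotonicity of the weight then covers all times.  The number of hubs with a leaf, which is
  at least a quarter of the weight, inherits the bound.\<close>

lemma AE_eventually_rich_hubs_1_ge:
  "AE \<omega> in friend_process. \<forall>\<^sub>F n in sequentially. 1 / 8 * real n powr (1 / 8) \<le> rich_hubs 1 (friend_tree \<omega> n)"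
proof -
  have "AE \<omega> in friend_process. \<forall>\<^sub>F i in sequentially.
      1 / hub_sum growth_weight (friend_tree \<omega> (2 ^ i)) \<le> (2 ^ i) powr (- (1 / 8))"
  proof (rule AE_eventually_le_dyadic[where f = "\<lambda>H. 1 / hub_sum growth_weight H"])
    show "(\<integral>\<^sup>+\<omega>. ennreal (1 / hub_sum growth_weight (friend_tree \<omega> n)) \<partial>friend_process) \<le>
        ennreal (3 * real n powr (- (1 / 7)))" if "3 \<le> n" for n
      using that by (rule nn_integral_inverse_growth)
  qed (auto intro: hub_sum_nonneg growth_weight_nonneg)
  then show ?thesis
    using AE_tree_history
  proof eventually_elim
    case (elim \<omega>)
    have "\<forall>\<^sub>F n in sequentially. (real n / 2) powr (1 / 8) \<le> hub_sum growth_weight (friend_tree \<omega> n)"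
    proof (rule eventually_ge_powr_if_dyadic)
      show "\<forall>\<^sub>F i in sequentially. (2 ^ i) powr (1 / 8) \<le> hub_sum growth_weight (friend_tree \<omega> (2 ^ i))"
        using elim(1) eventually_ge_at_top[of 2]
      proof eventually_elim
        fix i :: nat assume le: "1 / hub_sum growth_weight (friend_tree \<omega> (2 ^ i)) \<le> (2 ^ i) powr (- (1 / 8))" and i: "2 \<le> i"
        have "2 ^ 2 \<le> (2 ^ i :: nat)" using i by (rule power_increasing) simp
        then have "4 \<le> hub_sum growth_weight (friend_tree \<omega> (2 ^ i))"
          by (intro tree_history_growth_ge_4[OF elim(2)]) simp
        with le show "(2 ^ i) powr (1 / 8) \<le> hub_sum growth_weight (friend_tree \<omega> (2 ^ i))"
          by (simp add: powr_minus field_simps)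
      qed
    qed (use tree_history_growth_mono[OF elim(2)] in auto)
    then show ?case
      using eventually_ge_at_top[of 3]
    proof eventually_elim
      fix n :: nat assume le: "(real n / 2) powr (1 / 8) \<le> hub_sum growth_weight (friend_tree \<omega> n)" and n: "3 \<le> n"
      have "real n powr (1 / 8) \<le> 2 * (real n / 2) powr (1 / 8)"
        using mult_right_mono[OF powr_mono[of "1 / 8" 1 "2::real"], of "real n powr (1 / 8)"]
        by (simp add: powr_divide field_simps)
      moreover have "hub_sum growth_weight (friend_tree \<omega> n) \<le> 4 * rich_hubs 1 (friend_tree \<omega> n)"
        by (rule friend_graph.growth_le_rich[OF tree_history_friend_graph[OF elim(2) n]])
      ultimately show "1 / 8 * real n powr (1 / 8) \<le> rich_hubs 1 (friend_tree \<omega> n)"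
        using le by linarith
    qed
  qed
qed

section \<open>Hubs with many leaves\<close>

text \<open>$\exp(- (c/16) m^{1/8})$ is a supersolution of the recursion for the mean of $2^{-Z}$ with
  $b = c m^{1/8}$: its own relative decrease is at most $(c/16) m^{1/8}/m$, half of the contraction, and the
  other half absorbs the error term, which decays with a larger rate in the exponent.\<close>

lemma eventually_stretched_exp_step:
  fixes c :: real
  assumes c: "0 < c"
  shows "\<forall>\<^sub>F m in sequentially.
    (1 - c * real m powr (1 / 8) / (8 * real m)) * exp (- (c / 16 * real m powr (1 / 8))) +
      3 * 2 powr - (c * real m powr (1 / 8) / 4) \<le> exp (- (c / 16 * real (Suc m) powr (1 / 8)))"
proof -
  have "\<forall>\<^sub>F m in sequentially. 3 * exp (- (c / 16 * real m powr (1 / 8))) \<le>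
      c / 16 * real m powr (1 / 8) / real m"
    using c by real_asymp
  then show ?thesis
    using eventually_gt_at_top[of 0]
  proof eventually_elim
    case (elim m)
    define u where "u = real m powr (1 / 8)"
    have m: "1 \<le> real m" using elim(2) by simp
    have "(1 + 1 / real m) powr (1 / 8) \<le> (1 + 1 / real m) powr 1"
      using m by (intro powr_mono) auto
    then have "u * (1 + 1 / real m) powr (1 / 8) \<le> u * (1 + 1 / real m)"
      by (intro mult_left_mono) (auto simp: u_def)
    also have "u * (1 + 1 / real m) powr (1 / 8) = (real m * (1 + 1 / real m)) powr (1 / 8)"
      by (simp add: u_def powr_mult)
    also have "real m * (1 + 1 / real m) = real (Suc m)"
      using m by (simp add: field_simps)
    finally have growth: "real (Suc m) powr (1 / 8) \<le> u + u / real m"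
      by (simp add: field_simps)
    have "exp (- (c / 16 * u)) * (1 - c / 16 * u / real m) \<le> exp (- (c / 16 * u)) * exp (- (c / 16 * u / real m))"
      using exp_ge_add_one_self[of "- (c / 16 * u / real m)"] by (intro mult_left_mono) auto
    also have "\<dots> = exp (- (c / 16 * (u + u / real m)))"
      by (simp add: exp_add[symmetric] algebra_simps)
    also have "\<dots> \<le> exp (- (c / 16 * real (Suc m) powr (1 / 8)))"
      using mult_left_mono[OF growth, of "c / 16"] c by simp
    finally have "exp (- (c / 16 * u)) * (1 - c / 16 * u / real m) \<le> exp (- (c / 16 * real (Suc m) powr (1 / 8)))" .
    moreover have "3 * 2 powr - (c * u / 4) \<le> c / 16 * u / real m * exp (- (c / 16 * u))"
    proof -
      have "c * u / 4 * (1 / 2) \<le> c * u / 4 * ln 2"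
        using c ln2_ge_two_thirds by (intro mult_left_mono) (auto simp: u_def)
      then have "2 powr - (c * u / 4) \<le> exp (- (c / 16 * u) + - (c / 16 * u))"
        by (simp add: powr_def)
      also have "\<dots> = exp (- (c / 16 * u)) * exp (- (c / 16 * u))"
        by (rule exp_add)
      finally have "3 * 2 powr - (c * u / 4) \<le> (3 * exp (- (c / 16 * u))) * exp (- (c / 16 * u))"
        by simp
      also have "\<dots> \<le> c / 16 * u / real m * exp (- (c / 16 * u))"
        using elim(1) by (intro mult_right_mono) (auto simp: u_def)
      finally show ?thesis .
    qed
    moreover have "(1 - c * u / (8 * real m)) * exp (- (c / 16 * u)) + c / 16 * u / real m * exp (- (c / 16 * u)) =
        exp (- (c / 16 * u)) * (1 - c / 16 * u / real m)"
      by (simp add: field_simps)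
    ultimately show ?case unfolding u_def by linarith
  qed
qed

text \<open>The indicator that there have been enough hubs with at least \<open>j\<close> leaves at all times from \<open>N\<close> up to, but
  excluding, \<open>m\<close>.  It does not depend on the choice at time \<open>m\<close>, so that it can be carried through the recursion.\<close>

definition rich_since :: "real \<Rightarrow> nat \<Rightarrow> nat \<Rightarrow> nat \<Rightarrow> (nat \<Rightarrow> nat \<times> nat) \<Rightarrow> real" where
  "rich_since c j N m \<omega> = of_bool (\<forall>i\<in>{N..<m}. c * real i powr (1 / 8) \<le> rich_hubs j (friend_tree \<omega> i))"

lemma rich_since_cong:
  "(\<And>i. i < m \<Longrightarrow> \<omega> i = \<omega>' i) \<Longrightarrow> rich_since c j N m \<omega> = rich_since c j N m \<omega>'"
  unfolding rich_since_def
  by (intro arg_cong[where f = of_bool] ball_cong refl) (simp add: friend_tree_cong[of _ \<omega> \<omega>'])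

lemma borel_measurable_rich_since:
  fixes f :: "nat set set \<Rightarrow> real"
  shows "(\<lambda>\<omega>. rich_since c j N m \<omega> * f (friend_tree \<omega> m)) \<in> borel_measurable friend_process"
proof (rule borel_measurable_history_function)
  fix \<omega> \<omega>' :: "nat \<Rightarrow> nat \<times> nat" assume "\<And>i. i < m \<Longrightarrow> \<omega> i = \<omega>' i"
  then show "rich_since c j N m \<omega> * f (friend_tree \<omega> m) = rich_since c j N m \<omega>' * f (friend_tree \<omega>' m)"
    using rich_since_cong[of m \<omega> \<omega>'] friend_tree_cong[of m \<omega> \<omega>'] by simp
qed

text \<open>Where the indicator drops to 0 at time \<open>m\<close>, the left side vanishes; elsewhere
  \<open>step_mean_rich_le\<close> applies.  The assumption \<open>c \<le> 1\<close> keeps the contraction factor nonnegative.\<close>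

lemma nn_integral_rich_since_step:
  assumes j: "1 \<le> j" and c: "0 < c" "c \<le> 1" and m: "3 \<le> m" "N \<le> m"
  defines "V \<equiv> \<lambda>m \<omega>. rich_since c j N m \<omega> * 2 powr - rich_hubs (Suc j) (friend_tree \<omega> m)"
  assumes K: "0 \<le> K" and IH: "(\<integral>\<^sup>+\<omega>. ennreal (V m \<omega>) \<partial>friend_process) \<le> ennreal K"
  shows "(\<integral>\<^sup>+\<omega>. ennreal (V (Suc m) \<omega>) \<partial>friend_process) \<le>
    ennreal ((1 - c * real m powr (1 / 8) / (8 * real m)) * K + 3 * 2 powr - (c * real m powr (1 / 8) / 4))"
proof -
  define b where "b = c * real m powr (1 / 8)"
  have b0: "0 \<le> b" using c by (simp add: b_def)
  have "b \<le> 1 * real m powr 1"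
    unfolding b_def using c m by (intro mult_mono powr_mono) auto
  then have p: "0 \<le> 1 - b / (8 * real m)"
    using m by (simp add: field_simps)
  have "(\<integral>\<^sup>+\<omega>. ennreal (V (Suc m) \<omega>) \<partial>friend_process) \<le>
      (\<integral>\<^sup>+\<omega>. ennreal ((1 - b / (8 * real m)) * V m \<omega> + 3 * 2 powr - (b / 4)) \<partial>friend_process)"
    unfolding V_def
  proof (rule nn_integral_friend_tree_step_le[where f = "\<lambda>H. 2 powr - rich_hubs (Suc j) H"])
    fix \<omega> assume G: "friend_graph m (friend_tree \<omega> m)"
    show "rich_since c j N (Suc m) \<omega> * step_mean m (friend_tree \<omega> m) (\<lambda>H. 2 powr - rich_hubs (Suc j) H)
        \<le> (1 - b / (8 * real m)) * (rich_since c j N m \<omega> * 2 powr - rich_hubs (Suc j) (friend_tree \<omega> m)) + 3 * 2 powr - (b / 4)"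
    proof (cases "\<forall>i\<in>{N..<Suc m}. c * real i powr (1 / 8) \<le> rich_hubs j (friend_tree \<omega> i)")
      case True
      then have "b \<le> rich_hubs j (friend_tree \<omega> m)"
        using m by (auto simp: b_def)
      from friend_graph.step_mean_rich_le[OF G j b0 this] True show ?thesis
        by (simp add: rich_since_def)
    next
      case False
      then have zero: "rich_since c j N (Suc m) \<omega> = 0"
        unfolding rich_since_def by (simp only: of_bool_eq if_False refl)
      have "0 \<le> rich_since c j N m \<omega>" by (simp add: rich_since_def)
      with p show ?thesis unfolding zero by (simp add: mult_nonneg_nonneg)
    qed
  next
    fix \<omega> \<omega>' :: "nat \<Rightarrow> nat \<times> nat" assume eq: "\<And>i. i < m \<Longrightarrow> \<omega> i = \<omega>' i"
    have "friend_tree \<omega> i = friend_tree \<omega>' i" if "i \<in> {N..<Suc m}" for i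
      by (rule friend_tree_cong) (use that eq in auto)
    then show "rich_since c j N (Suc m) \<omega> = rich_since c j N (Suc m) \<omega>'"
      unfolding rich_since_def by (intro arg_cong[where f = of_bool] ball_cong refl) simp
  qed (use m in \<open>auto simp: rich_since_def\<close>)
  also have "\<dots> = (\<integral>\<^sup>+\<omega>. ennreal (1 - b / (8 * real m)) * ennreal (V m \<omega>) + ennreal (3 * 2 powr - (b / 4)) \<partial>friend_process)"
    using p by (intro nn_integral_cong) (simp add: V_def rich_since_def ennreal_mult'[symmetric] ennreal_plus[symmetric] del: ennreal_plus)
  also have "\<dots> = ennreal (1 - b / (8 * real m)) * (\<integral>\<^sup>+\<omega>. ennreal (V m \<omega>) \<partial>friend_process) + ennreal (3 * 2 powr - (b / 4))"
  proof -
    have meas: "(\<lambda>\<omega>. ennreal (V m \<omega>)) \<in> borel_measurable friend_process"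
      unfolding V_def by (intro measurable_compose[OF borel_measurable_rich_since[of c j N m "\<lambda>H. 2 powr - rich_hubs (Suc j) H"]] measurable_ennreal)
    then show ?thesis
      using prob_space.emeasure_space_1[OF prob_space_friend_process]
      by (simp add: nn_integral_add nn_integral_cmult)
  qed
  also have "\<dots> \<le> ennreal (1 - b / (8 * real m)) * ennreal K + ennreal (3 * 2 powr - (b / 4))"
    by (intro add_mono mult_left_mono IH) auto
  also have "\<dots> = ennreal ((1 - b / (8 * real m)) * K + 3 * 2 powr - (b / 4))"
    using p K by (simp add: ennreal_mult'[symmetric] ennreal_plus[symmetric] del: ennreal_plus)
  finally show ?thesis by (simp only: b_def)
qed

lemma nn_integral_rich_since:
  assumes j: "1 \<le> j" and c: "0 < c" "c \<le> 1" and N: "3 \<le> N"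
    and step: "\<And>m. N \<le> m \<Longrightarrow> (1 - c * real m powr (1 / 8) / (8 * real m)) * exp (- (c / 16 * real m powr (1 / 8))) +
      3 * 2 powr - (c * real m powr (1 / 8) / 4) \<le> exp (- (c / 16 * real (Suc m) powr (1 / 8)))"
    and m: "N \<le> m"
  shows "(\<integral>\<^sup>+\<omega>. ennreal (rich_since c j N m \<omega> * 2 powr - rich_hubs (Suc j) (friend_tree \<omega> m)) \<partial>friend_process) \<le>
    ennreal (exp (c / 16 * real N powr (1 / 8)) * exp (- (c / 16 * real m powr (1 / 8))))"
  using m
proof (induction m rule: dec_induct)
  case base
  have "(\<integral>\<^sup>+\<omega>. ennreal (rich_since c j N N \<omega> * 2 powr - rich_hubs (Suc j) (friend_tree \<omega> N)) \<partial>friend_process) \<le>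
      (\<integral>\<^sup>+\<omega>. ennreal 1 \<partial>friend_process)"
    using rich_hubs_nonneg powr_mono[of "- rich_hubs (Suc j) _" 0 2]
    by (intro nn_integral_mono ennreal_leI) (auto simp: rich_since_def)
  also have "\<dots> = ennreal 1"
    using prob_space.emeasure_space_1[OF prob_space_friend_process] by simp
  finally show ?case by (simp flip: exp_add)
next
  case (step m)
  let ?K = "exp (c / 16 * real N powr (1 / 8))"
  have "(\<integral>\<^sup>+\<omega>. ennreal (rich_since c j N (Suc m) \<omega> * 2 powr - rich_hubs (Suc j) (friend_tree \<omega> (Suc m))) \<partial>friend_process) \<le>
    ennreal ((1 - c * real m powr (1 / 8) / (8 * real m)) * (?K * exp (- (c / 16 * real m powr (1 / 8)))) +
      3 * 2 powr - (c * real m powr (1 / 8) / 4))"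
    using step.hyps N by (intro nn_integral_rich_since_step j c step.IH) auto
  also have "\<dots> \<le> ennreal (?K * exp (- (c / 16 * real (Suc m) powr (1 / 8))))"
  proof (rule ennreal_leI)
    have "1 \<le> ?K" using c by simp
    define x y where "x = (1 - c * real m powr (1 / 8) / (8 * real m)) * exp (- (c / 16 * real m powr (1 / 8)))"
      and "y = 3 * 2 powr - (c * real m powr (1 / 8) / 4)"
    have "1 * y \<le> ?K * y"
      using \<open>1 \<le> ?K\<close> by (rule mult_right_mono) (simp add: y_def)
    then have "?K * x + y \<le> ?K * (x + y)" by (simp add: distrib_left)
    also have "\<dots> \<le> ?K * exp (- (c / 16 * real (Suc m) powr (1 / 8)))"
      using assms(5)[OF step.hyps(1)] by (intro mult_left_mono) (simp_all add: x_def y_def)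
    finally show "(1 - c * real m powr (1 / 8) / (8 * real m)) * (?K * exp (- (c / 16 * real m powr (1 / 8)))) +
      3 * 2 powr - (c * real m powr (1 / 8) / 4) \<le> ?K * exp (- (c / 16 * real (Suc m) powr (1 / 8)))"
      unfolding x_def y_def by (simp only: mult.left_commute)
  qed
  finally show ?case .
qed

text \<open>Almost every history lies, for some \<open>N\<close>, in the event that the lower bound for \<open>j\<close> holds from
  time \<open>N\<close> on.  On each of these events $2^{-Z}$ is summably small even after multiplication by
  $\exp((c/32) m^{1/8})$, where \<open>Z\<close> counts the hubs with more than \<open>j\<close> leaves.\<close>

lemma AE_rich_hubs_Suc:
  assumes j: "1 \<le> j" and c: "0 < c" "c \<le> 1"
    and IH: "AE \<omega> in friend_process. \<forall>\<^sub>F n in sequentially. c * real n powr (1 / 8) \<le> rich_hubs j (friend_tree \<omega> n)"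
  shows "AE \<omega> in friend_process. \<forall>\<^sub>F n in sequentially. c / 32 * real n powr (1 / 8) \<le> rich_hubs (Suc j) (friend_tree \<omega> n)"
proof -
  let ?u = "\<lambda>m. real m powr (1 / 8)"
  obtain N0 where N0: "\<And>m. N0 \<le> m \<Longrightarrow> (1 - c * ?u m / (8 * real m)) * exp (- (c / 16 * ?u m)) +
      3 * 2 powr - (c * ?u m / 4) \<le> exp (- (c / 16 * ?u (Suc m)))"
    using eventually_stretched_exp_step[OF c(1)] by (auto simp only: eventually_sequentially)
  define V where "V = (\<lambda>N m \<omega>. rich_since c j N m \<omega> * 2 powr - rich_hubs (Suc j) (friend_tree \<omega> m))"
  have "AE \<omega> in friend_process. (\<lambda>i. V N (i + N) \<omega> * exp (c / 32 * ?u (i + N))) \<longlonglongrightarrow> 0"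
    if N: "max 3 N0 \<le> N" for N
  proof (rule AE_tendsto_zero_if_summable)
    let ?b = "\<lambda>i. exp (c / 16 * ?u N) * exp (- (c / 32 * ?u i))"
    show "(\<lambda>\<omega>. V N (i + N) \<omega> * exp (c / 32 * ?u (i + N))) \<in> borel_measurable friend_process" for i
      unfolding V_def by (intro borel_measurable_times borel_measurable_rich_since borel_measurable_const)
    show "0 \<le> V N (i + N) \<omega> * exp (c / 32 * ?u (i + N))" for i \<omega>
      by (simp add: V_def rich_since_def)
    show "0 \<le> ?b (i + N)" for i by simp
    show "summable (\<lambda>i. ?b (i + N))"
    proof -
      have "\<forall>\<^sub>F i in sequentially. exp (- (c / 32 * ?u i)) \<le> inverse (real i ^ 2)"
        using c by real_asymp
      then have "\<forall>\<^sub>F i in sequentially. norm (exp (- (c / 32 * ?u i))) \<le> inverse (real i ^ 2)" by simp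
      from summable_comparison_test_ev[OF this inverse_power_summable]
      have "summable (\<lambda>i. exp (- (c / 32 * ?u i)))" by simp
      then have "summable ?b" by (rule summable_mult)
      then show ?thesis by (rule summable_ignore_initial_segment)
    qed
    show "(\<integral>\<^sup>+\<omega>. ennreal (V N (i + N) \<omega> * exp (c / 32 * ?u (i + N))) \<partial>friend_process) \<le> ennreal (?b (i + N))" for i
    proof -
      let ?m = "i + N"
      have "(\<integral>\<^sup>+\<omega>. ennreal (V N ?m \<omega> * exp (c / 32 * ?u ?m)) \<partial>friend_process) =
          (\<integral>\<^sup>+\<omega>. ennreal (exp (c / 32 * ?u ?m)) * ennreal (V N ?m \<omega>) \<partial>friend_process)"
        by (intro nn_integral_cong) (subst mult.commute, rule ennreal_mult', simp)
      also have "\<dots> = ennreal (exp (c / 32 * ?u ?m)) * (\<integral>\<^sup>+\<omega>. ennreal (V N ?m \<omega>) \<partial>friend_process)"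
        unfolding V_def
        by (intro nn_integral_cmult measurable_compose[OF borel_measurable_rich_since[of c j N ?m "\<lambda>H. 2 powr - rich_hubs (Suc j) H"]] measurable_ennreal)
      also have "\<dots> \<le> ennreal (exp (c / 32 * ?u ?m)) * ennreal (exp (c / 16 * ?u N) * exp (- (c / 16 * ?u ?m)))"
        unfolding V_def using N N0 by (intro mult_left_mono nn_integral_rich_since j c) auto
      also have "\<dots> = ennreal (?b ?m)"
        by (simp add: ennreal_mult'[symmetric] exp_add[symmetric] algebra_simps)
      finally show ?thesis .
    qed
  qed
  then have "AE \<omega> in friend_process. \<forall>N. max 3 N0 \<le> N \<longrightarrow> (\<lambda>i. V N (i + N) \<omega> * exp (c / 32 * ?u (i + N))) \<longlonglongrightarrow> 0"
    unfolding AE_all_countable by auto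
  with IH show ?thesis
  proof eventually_elim
    case (elim \<omega>)
    from elim(1) obtain N1 where N1: "\<And>n. N1 \<le> n \<Longrightarrow> c * ?u n \<le> rich_hubs j (friend_tree \<omega> n)"
      by (auto simp only: eventually_sequentially)
    define N where "N = max N1 (max 3 N0)"
    have "max 3 N0 \<le> N" by (simp add: N_def)
    with elim(2) have "(\<lambda>i. V N (i + N) \<omega> * exp (c / 32 * ?u (i + N))) \<longlonglongrightarrow> 0" by blast
    from order_tendstoD(2)[OF this, of 1]
    have "\<forall>\<^sub>F i in sequentially. V N (i + N) \<omega> * exp (c / 32 * ?u (i + N)) < 1" by simp
    then have "\<forall>\<^sub>F m in sequentially. V N m \<omega> * exp (c / 32 * ?u m) < 1"
      by (subst (asm) eventually_sequentially_seg[of "\<lambda>m. V N m \<omega> * exp (c / 32 * ?u m) < 1"])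
    then show ?case
    proof eventually_elim
      fix m assume lt: "V N m \<omega> * exp (c / 32 * ?u m) < 1"
      define Z where "Z = rich_hubs (Suc j) (friend_tree \<omega> m)"
      have "rich_since c j N m \<omega> = 1"
        using N1 by (simp add: rich_since_def N_def)
      then have "V N m \<omega> = exp (- (Z * ln 2))"
        by (simp add: V_def Z_def powr_def)
      with lt have "exp (c / 32 * ?u m - Z * ln 2) < exp 0"
        by (simp add: exp_diff exp_minus field_simps)
      then have "c / 32 * ?u m < Z * ln 2" using exp_less_cancel by fastforce
      also have "Z * ln 2 \<le> Z * 1"
        using rich_hubs_nonneg ln_2_less_1 by (intro mult_left_mono) (auto simp: Z_def)
      finally show "c / 32 * ?u m \<le> rich_hubs (Suc j) (friend_tree \<omega> m)" by (simp add: Z_def)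
    qed
  qed
qed

lemma AE_rich_hubs:
  assumes "1 \<le> j"
  shows "\<exists>c>0. c \<le> 1 \<and> (AE \<omega> in friend_process. \<forall>\<^sub>F n in sequentially. c * real n powr (1 / 8) \<le> rich_hubs j (friend_tree \<omega> n))"
  using assms
proof (induction j rule: dec_induct)
  case base
  show ?case using AE_eventually_rich_hubs_1_ge by (intro exI[of _ "1 / 8"]) auto
next
  case (step j)
  then obtain c where c: "0 < c" "c \<le> 1" 
    "AE \<omega> in friend_process. \<forall>\<^sub>F n in sequentially. c * real n powr (1 / 8) \<le> rich_hubs j (friend_tree \<omega> n)"
    by blast
  from AE_rich_hubs_Suc[OF step.hyps(1) this] c(1,2) show ?case
    by (intro exI[of _ "c / 32"]) auto
qed

section \<open>The degree counts\<close>

theorem theorem4p7: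
  shows "\<exists>\<delta> \<Lambda> :: real. 0.1 < \<delta> \<and> \<delta> \<le> \<Lambda> \<and> \<Lambda> < 0.9 \<and>
    (\<forall>k::nat. k \<ge> 2 \<longrightarrow>
      (AE \<omega> in friend_process.
        filterlim (\<lambda>n. real (num_degree_ge k n \<omega>) / real n powr \<delta>) at_top sequentially \<and>
        (\<lambda>n. real (num_degree_ge k n \<omega>) / real n powr \<Lambda>) \<longlonglongrightarrow> 0))"
proof (intro exI conjI allI impI)
  fix k :: nat assume k: "2 \<le> k"
  then obtain c where c: "0 < c"
    "AE \<omega> in friend_process. \<forall>\<^sub>F n in sequentially. c * real n powr (1 / 8) \<le> rich_hubs k (friend_tree \<omega> n)"
    using AE_rich_hubs[of k] by auto
  show "AE \<omega> in friend_process.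
      filterlim (\<lambda>n. real (num_degree_ge k n \<omega>) / real n powr (1 / 9)) at_top sequentially \<and>
      (\<lambda>n. real (num_degree_ge k n \<omega>) / real n powr (7 / 8)) \<longlonglongrightarrow> 0"
    using c(2) AE_eventually_card_hubs_le AE_tree_history
  proof eventually_elim
    case (elim \<omega>)
    let ?X = "\<lambda>n. real (num_degree_ge k n \<omega>)"
    have lower: "\<forall>\<^sub>F n in sequentially. c * real n powr (1 / 8) \<le> ?X n"
      using elim(1) eventually_ge_at_top[of 3]
    proof eventually_elim
      fix n assume n: "3 \<le> n" and le: "c * real n powr (1 / 8) \<le> rich_hubs k (friend_tree \<omega> n)"
      from friend_graph.rich_hubs_le[OF tree_history_friend_graph[OF elim(3) n], of k] le
      show "c * real n powr (1 / 8) \<le> ?X n" by (simp add: num_degree_ge_def)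
    qed
    have upper: "\<forall>\<^sub>F n in sequentially. ?X n \<le> 2 powr (6 / 7) * real n powr (6 / 7)"
      using elim(2) eventually_ge_at_top[of 3]
    proof eventually_elim
      fix n assume n: "3 \<le> n" and le: "real (card (hubs (friend_tree \<omega> n))) \<le> 2 powr (6 / 7) * real n powr (6 / 7)"
      have "num_degree_ge k n \<omega> \<le> card (hubs (friend_tree \<omega> n))"
        unfolding num_degree_ge_def hubs_def
        using friend_graph.finite_hubs[OF tree_history_friend_graph[OF elim(3) n]] k
        by (intro card_mono) (auto simp: hubs_def)
      with le show "?X n \<le> 2 powr (6 / 7) * real n powr (6 / 7)" by linarith
    qed
    have "filterlim (\<lambda>n. c * real n powr (1 / 8) / real n powr (1 / 9)) at_top sequentially"
      using c(1) by real_asymp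
    moreover have "\<forall>\<^sub>F n in sequentially. c * real n powr (1 / 8) / real n powr (1 / 9) \<le> ?X n / real n powr (1 / 9)"
      using lower by eventually_elim (simp add: divide_right_mono)
    ultimately have 1: "filterlim (\<lambda>n. ?X n / real n powr (1 / 9)) at_top sequentially"
      by (rule filterlim_at_top_mono)
    have 2: "(\<lambda>n. ?X n / real n powr (7 / 8)) \<longlonglongrightarrow> 0"
    proof (rule tendsto_sandwich[OF _ _ tendsto_const])
      show "\<forall>\<^sub>F n in sequentially. 0 \<le> ?X n / real n powr (7 / 8)" by simp
      show "\<forall>\<^sub>F n in sequentially. ?X n / real n powr (7 / 8) \<le> 2 powr (6 / 7) * real n powr (6 / 7) / real n powr (7 / 8)"
        using upper by eventually_elim (simp add: divide_right_mono)
      show "(\<lambda>n. 2 powr (6 / 7) * real n powr (6 / 7) / real n powr (7 / 8)) \<longlonglongrightarrow> 0"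
        by real_asymp
    qed
    from 1 2 show ?case by blast
  qed
qed simp_all

end
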